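(* Let $\zeta_1(y)$ and $\zeta_2(y)$ be two arbitrary functions defined on an open interval $(c,d)\subset\mathbb{R}$ (possibly $(c,d)=\mathbb{R}$) with $\zeta_2(y)\neq0$ for all $y\in(c,d)$. Then: (1) there exist an open set $U\subset(e,f)\times(c,d)\subset(\mathbb{R}^2;x,y)$, for some $(e,f)\subset\mathbb{R}$, and an embedding $X:U\to H_1$ such that $\Sigma=X(U)$ is a $p$-minimal surface of special type I with $(x,y)$ as a normal coordinate system and $\zeta_1(y)$ as its $\zeta_1$-invariant; likewise there exist such $U$ and $X$ for which $\Sigma=X(U)$ is a $p$-minimal surface of special type II with $(x,y)$ as a normal coordinate system and $\zeta_1(y)$ as its $\zeta_1$-invariant; (2) there exist an open set $U\subset(e,f)\times(c,d)\subset(\mathbb{R}^2;x,y)$, for some $(e,f)\subset\mathbb{R}$, and an embedding $X:U\to H_1$ such that $\Sigma=X(U)$ is a $p$-minimal surface of general type with $(x,y)$ as a normal coordinate system and $\zeta_1(y)$, $\zeta_2(y)$ as its $\zeta_1$- and $\zeta_2$-invariants. Moreover, such embeddings in (1) and (2) are unique up to a Heisenberg rigid motion.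
   Context: The Heisenberg group $H_1$ is $\mathbb{R}^3$ with the group law $(x_1,y_1,z_1)\circ(x_2,y_2,z_2)=(x_1+x_2,\,y_1+y_2,\,z_1+z_2+y_1x_2-x_1y_2)$. Left invariant fields: $\mathring e_1=\partial_x+y\partial_z$, $\mathring e_2=\partial_y-x\partial_z$, $T=\partial_z$. Contact form $\Theta=dz+x\,dy-y\,dx$, contact bundle $\xi=\ker\Theta$, $J\mathring e_1=\mathring e_2$, $J\mathring e_2=-\mathring e_1$. The adapted metric makes $\mathring e_1,\mathring e_2,T$ orthonormal; $\nabla$ is the connection for which they are parallel. A Heisenberg rigid motion is a diffeomorphism of $H_1$ preserving $(J,\Theta)$. All objects (including $\zeta_1,\zeta_2$) are $C^\infty$; open sets $U$ are nonempty coordinate neighborhoods (connected). For a surface $\Sigma\subset H_1$, a point is singular if $T_p\Sigma=\xi_p$, otherwise regular. On the regular part choose a unit field $e_1\in T\Sigma\cap\xi$ (characteristic direction, determined up to sign), $e_2=Je_1$; the $p$-mean curvature $H$ is defined by $\nabla_{e_1}e_2=-He_1$; $\Sigma$ is $p$-minimal if $H=0$ on the regular part. The $\alpha$-function is defined by $\alpha e_2+T\in T\Sigma$; put $\hat e_1=e_1$, $\hat e_2=\frac{\alpha e_2+T}{\sqrt{1+\alpha^2}}$. A compatible coordinate system is one with $e_1=\partial_x$; then $\hat e_2=a\,\partial_x+b\,\partial_y$ with $b>0$. Types and invariants. Coordinates $(x,y)$ on a $p$-minimal surface without singular points are normal, with invariants $\zeta_1$ (and $\zeta_2$), if they are compatible,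 $a=0$, and: for special type I, $\alpha=\frac1{x+\zeta_1(y)}$, $b=\frac{\alpha^2}{\sqrt{1+\alpha^2}}$; for special type II, $\alpha=\frac1{2x+\zeta_1(y)}$, $b=\frac{|\alpha|}{\sqrt{1+\alpha^2}}$; for general type, $\alpha=\frac{x+\zeta_1(y)}{(x+\zeta_1(y))^2+\zeta_2(y)}$ with $\zeta_2\neq0$ everywhere, $b=\frac{|\alpha|}{|x+\zeta_1(y)|\sqrt{1+\alpha^2}}$ (the quotient $|\alpha|/|x+\zeta_1|$ understood as $1/|(x+\zeta_1)^2+\zeta_2|$ where $x+\zeta_1=0$). *)

theory Defs
  imports "HOL-Analysis.Analysis"
begin

section \<open>Smooth maps\<close>

(* Intended for open S: all iterated directional derivatives up to order k exist
   as Frechet derivatives on S and are continuous there. *)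
fun Ck_on :: "nat \<Rightarrow> ('a::euclidean_space \<Rightarrow> 'b::euclidean_space) \<Rightarrow> 'a set \<Rightarrow> bool" where
  "Ck_on 0 f S \<longleftrightarrow> continuous_on S f"
| "Ck_on (Suc k) f S \<longleftrightarrow>
     (\<forall>x\<in>S. f differentiable (at x)) \<and>
     (\<forall>v. Ck_on k (\<lambda>x. frechet_derivative f (at x) v) S)"

definition smooth_on :: "('a::euclidean_space \<Rightarrow> 'b::euclidean_space) \<Rightarrow> 'a set \<Rightarrow> bool" where
  "smooth_on f S \<longleftrightarrow> (\<forall>k. Ck_on k f S)"


section \<open>The Heisenberg group\<close>

type_synonym heis = "real \<times> real \<times> real"

fun heis_mult :: "heis \<Rightarrow> heis \<Rightarrow> heis" where
  "heis_mult (x1, y1, z1) (x2, y2, z2) =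
     (x1 + x2, y1 + y2, z1 + z2 + y1 * x2 - x1 * y2)"

fun frame1 :: "heis \<Rightarrow> heis" where
  "frame1 (x, y, z) = (1, 0, y)"

fun frame2 :: "heis \<Rightarrow> heis" where
  "frame2 (x, y, z) = (0, 1, - x)"

definition reeb :: "heis \<Rightarrow> heis" where
  "reeb p = (0, 0, 1)"

fun contact_form :: "heis \<Rightarrow> heis \<Rightarrow> real" where
  "contact_form (x, y, z) (u, v, w) = w + x * v - y * u"

definition contact_plane :: "heis \<Rightarrow> heis set" where
  "contact_plane p = {v. contact_form p v = 0}"

(* The complex structure J at p. It is only meaningful (and only used) on the contact plane;
   the formula extends it by sending the Reeb field to 0. *)
fun heis_J :: "heis \<Rightarrow> heis \<Rightarrow> heis" where
  "heis_J p (u, v, w) = u *\<^sub>R frame2 p - v *\<^sub>R frame1 p"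

fun heis_metric :: "heis \<Rightarrow> heis \<Rightarrow> heis \<Rightarrow> real" where
  "heis_metric p (u, v, w) (u', v', w') =
     u * u' + v * v' + contact_form p (u, v, w) * contact_form p (u', v', w')"

lemma frames_left_invariant:
  "(heis_mult p has_derivative D) (at q) \<Longrightarrow>
     D (frame1 q) = frame1 (heis_mult p q) \<and>
     D (frame2 q) = frame2 (heis_mult p q) \<and>
     D (reeb q) = reeb (heis_mult p q)"
proof -
  assume D: "(heis_mult p has_derivative D) (at q)"
  obtain a b c where p: "p = (a, b, c)" by (cases p)
  obtain x y z where q: "q = (x, y, z)" by (cases q)
  have mult: "heis_mult p =
      (\<lambda>r. (a + fst r, b + fst (snd r), c + snd (snd r) + b * fst r - a * fst (snd r)))"
    by (auto simp: fun_eq_iff p)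
  have "(heis_mult p has_derivative
      (\<lambda>r. (fst r, fst (snd r), snd (snd r) + b * fst r - a * fst (snd r)))) (at q)"
    unfolding mult by (auto intro!: derivative_eq_intros)
  then have "D = (\<lambda>r. (fst r, fst (snd r), snd (snd r) + b * fst r - a * fst (snd r)))"
    using D has_derivative_unique by blast
  then show ?thesis by (simp add: p q reeb_def)
qed

lemma frame_orthonormal:
  "heis_metric p (frame1 p) (frame1 p) = 1" "heis_metric p (frame2 p) (frame2 p) = 1"
  "heis_metric p (reeb p) (reeb p) = 1" "heis_metric p (frame1 p) (frame2 p) = 0"
  "heis_metric p (frame1 p) (reeb p) = 0" "heis_metric p (frame2 p) (reeb p) = 0"
  by (cases p; simp add: reeb_def)+

lemma heis_J_frame:
  "heis_J p (frame1 p) = frame2 p" "heis_J p (frame2 p) = - frame1 p"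
  by (cases p; simp)+

definition rigid_motion :: "(heis \<Rightarrow> heis) \<Rightarrow> bool" where
  "rigid_motion \<Phi> \<longleftrightarrow>
     bij \<Phi> \<and> smooth_on \<Phi> UNIV \<and> smooth_on (inv \<Phi>) UNIV \<and>
     (\<forall>p v. contact_form (\<Phi> p) (frechet_derivative \<Phi> (at p) v) = contact_form p v) \<and>
     (\<forall>p. \<forall>v\<in>contact_plane p.
        frechet_derivative \<Phi> (at p) (heis_J p v) = heis_J (\<Phi> p) (frechet_derivative \<Phi> (at p) v))"

definition rigidly_congruent ::
    "(real \<times> real) set \<Rightarrow> (real \<times> real \<Rightarrow> heis) \<Rightarrow> (real \<times> real \<Rightarrow> heis) \<Rightarrow> bool" where
  "rigidly_congruent U X X' \<longleftrightarrow> (\<exists>\<Phi>. rigid_motion \<Phi> \<and> (\<forall>q\<in>U. X' q = \<Phi> (X q)))"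


section \<open>Surfaces\<close>

(* A surface is given by a global parametrization X on U, Sigma = X ` U. Functions and vector
   fields on Sigma are functions of the parameter q, with the value at q attached to X q. *)

definition coordinate_neighborhood :: "(real \<times> real) set \<Rightarrow> bool" where
  "coordinate_neighborhood U \<longleftrightarrow> open U \<and> connected U \<and> U \<noteq> {}"

definition embedding :: "(real \<times> real) set \<Rightarrow> (real \<times> real \<Rightarrow> heis) \<Rightarrow> bool" where
  "embedding U X \<longleftrightarrow>
     smooth_on X U \<and>
     (\<forall>q\<in>U. inj (frechet_derivative X (at q))) \<and>
     (\<exists>g. homeomorphism U (X ` U) X g)"

definition tangent_plane :: "(real \<times> real \<Rightarrow> heis) \<Rightarrow> real \<times> real \<Rightarrow> heis set" where
  "tangent_plane X q = range (frechet_derivative X (at q))"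

definition singular_point :: "(real \<times> real \<Rightarrow> heis) \<Rightarrow> real \<times> real \<Rightarrow> bool" where
  "singular_point X q \<longleftrightarrow> tangent_plane X q = contact_plane (X q)"

definition coord_dx :: "(real \<times> real \<Rightarrow> heis) \<Rightarrow> real \<times> real \<Rightarrow> heis" where
  "coord_dx X q = frechet_derivative X (at q) (1, 0)"

definition coord_dy :: "(real \<times> real \<Rightarrow> heis) \<Rightarrow> real \<times> real \<Rightarrow> heis" where
  "coord_dy X q = frechet_derivative X (at q) (0, 1)"

(* Covariant derivative at X q, in the tangent direction dX(w), of a field V along X:
   the left invariant frame is parallel, so only its coefficients are differentiated. *)
definition nabla ::
    "(real \<times> real \<Rightarrow> heis) \<Rightarrow> (real \<times> real \<Rightarrow> heis) \<Rightarrow> real \<times> real \<Rightarrow> real \<times> real \<Rightarrow> heis" where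
  "nabla X V q w =
     frechet_derivative (\<lambda>r. heis_metric (X r) (V r) (frame1 (X r))) (at q) w *\<^sub>R frame1 (X q) +
     frechet_derivative (\<lambda>r. heis_metric (X r) (V r) (frame2 (X r))) (at q) w *\<^sub>R frame2 (X q) +
     frechet_derivative (\<lambda>r. heis_metric (X r) (V r) (reeb (X r))) (at q) w *\<^sub>R reeb (X q)"

definition characteristic_field ::
    "(real \<times> real) set \<Rightarrow> (real \<times> real \<Rightarrow> heis) \<Rightarrow> (real \<times> real \<Rightarrow> heis) \<Rightarrow> bool" where
  "characteristic_field W X e1 \<longleftrightarrow>
     smooth_on e1 W \<and>
     (\<forall>q\<in>W. e1 q \<in> tangent_plane X q \<inter> contact_plane (X q) \<and>
            heis_metric (X q) (e1 q) (e1 q) = 1)"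

definition has_p_mean_curvature ::
    "(real \<times> real \<Rightarrow> heis) \<Rightarrow> (real \<times> real \<Rightarrow> heis) \<Rightarrow> real \<times> real \<Rightarrow> real \<Rightarrow> bool" where
  "has_p_mean_curvature X e1 q H \<longleftrightarrow>
     (\<exists>w. frechet_derivative X (at q) w = e1 q \<and>
          nabla X (\<lambda>r. heis_J (X r) (e1 r)) q w = - H *\<^sub>R e1 q)"

(* The characteristic field exists only locally on the regular part and is determined up to
   sign; H = 0 is required for every local choice. *)
definition p_minimal :: "(real \<times> real) set \<Rightarrow> (real \<times> real \<Rightarrow> heis) \<Rightarrow> bool" where
  "p_minimal U X \<longleftrightarrow>
     (\<forall>W e1. open W \<and> W \<subseteq> U \<and> (\<forall>q\<in>W. \<not> singular_point X q) \<and> characteristic_field W X e1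
        \<longrightarrow> (\<forall>q\<in>W. has_p_mean_curvature X e1 q 0))"

definition is_alpha_function ::
    "(real \<times> real) set \<Rightarrow> (real \<times> real \<Rightarrow> heis) \<Rightarrow> (real \<times> real \<Rightarrow> heis) \<Rightarrow>
     (real \<times> real \<Rightarrow> real) \<Rightarrow> bool" where
  "is_alpha_function U X e1 \<alpha> \<longleftrightarrow>
     (\<forall>q\<in>U. \<alpha> q *\<^sub>R heis_J (X q) (e1 q) + reeb (X q) \<in> tangent_plane X q)"

definition e2_hat ::
    "(real \<times> real \<Rightarrow> heis) \<Rightarrow> (real \<times> real \<Rightarrow> heis) \<Rightarrow> (real \<times> real \<Rightarrow> real) \<Rightarrow>
     real \<times> real \<Rightarrow> heis" where
  "e2_hat X e1 \<alpha> q =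
     (1 / sqrt (1 + (\<alpha> q)\<^sup>2)) *\<^sub>R (\<alpha> q *\<^sub>R heis_J (X q) (e1 q) + reeb (X q))"

(* The coordinates are compatible for the choice of characteristic field e1 = d/dx, and
   \<alpha>, a, b are the resulting functions. *)
definition compatible_coordinates ::
    "(real \<times> real) set \<Rightarrow> (real \<times> real \<Rightarrow> heis) \<Rightarrow> (real \<times> real \<Rightarrow> real) \<Rightarrow>
     (real \<times> real \<Rightarrow> real) \<Rightarrow> (real \<times> real \<Rightarrow> real) \<Rightarrow> bool" where
  "compatible_coordinates U X \<alpha> a b \<longleftrightarrow>
     characteristic_field U X (coord_dx X) \<and>
     is_alpha_function U X (coord_dx X) \<alpha> \<and>
     (\<forall>q\<in>U. e2_hat X (coord_dx X) \<alpha> q = a q *\<^sub>R coord_dx X q + b q *\<^sub>R coord_dy X q \<and> b q > 0)"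

definition p_minimal_regular :: "(real \<times> real) set \<Rightarrow> (real \<times> real \<Rightarrow> heis) \<Rightarrow> bool" where
  "p_minimal_regular U X \<longleftrightarrow> p_minimal U X \<and> (\<forall>q\<in>U. \<not> singular_point X q)"


section \<open>Normal coordinates\<close>

(* The conditions that a denominator is nonzero say that the formula for \<alpha> is meaningful
   on all of U; they are needed because 1 / 0 = 0 in HOL. *)

definition normal_special_I ::
    "(real \<times> real) set \<Rightarrow> (real \<times> real \<Rightarrow> heis) \<Rightarrow> (real \<Rightarrow> real) \<Rightarrow> bool" where
  "normal_special_I U X \<zeta>1 \<longleftrightarrow>
     p_minimal_regular U X \<and>
     (\<exists>\<alpha> a b. compatible_coordinates U X \<alpha> a b \<and>
        (\<forall>x y. (x, y) \<in> U \<longrightarrow>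
           a (x, y) = 0 \<and>
           x + \<zeta>1 y \<noteq> 0 \<and>
           \<alpha> (x, y) = 1 / (x + \<zeta>1 y) \<and>
           b (x, y) = (\<alpha> (x, y))\<^sup>2 / sqrt (1 + (\<alpha> (x, y))\<^sup>2)))"

definition normal_special_II ::
    "(real \<times> real) set \<Rightarrow> (real \<times> real \<Rightarrow> heis) \<Rightarrow> (real \<Rightarrow> real) \<Rightarrow> bool" where
  "normal_special_II U X \<zeta>1 \<longleftrightarrow>
     p_minimal_regular U X \<and>
     (\<exists>\<alpha> a b. compatible_coordinates U X \<alpha> a b \<and>
        (\<forall>x y. (x, y) \<in> U \<longrightarrow>
           a (x, y) = 0 \<and>
           2 * x + \<zeta>1 y \<noteq> 0 \<and>
           \<alpha> (x, y) = 1 / (2 * x + \<zeta>1 y) \<and>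
           b (x, y) = \<bar>\<alpha> (x, y)\<bar> / sqrt (1 + (\<alpha> (x, y))\<^sup>2)))"

(* Where x + \<zeta>1 y = 0, the quotient |\<alpha>| / |x + \<zeta>1 y| stands for its continuous extension. *)
definition normal_general ::
    "(real \<times> real) set \<Rightarrow> (real \<times> real \<Rightarrow> heis) \<Rightarrow> (real \<Rightarrow> real) \<Rightarrow> (real \<Rightarrow> real) \<Rightarrow> bool" where
  "normal_general U X \<zeta>1 \<zeta>2 \<longleftrightarrow>
     p_minimal_regular U X \<and>
     (\<exists>\<alpha> a b. compatible_coordinates U X \<alpha> a b \<and>
        (\<forall>x y. (x, y) \<in> U \<longrightarrow>
           a (x, y) = 0 \<and>
           \<zeta>2 y \<noteq> 0 \<and>
           (x + \<zeta>1 y)\<^sup>2 + \<zeta>2 y \<noteq> 0 \<and>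
           \<alpha> (x, y) = (x + \<zeta>1 y) / ((x + \<zeta>1 y)\<^sup>2 + \<zeta>2 y) \<and>
           b (x, y) =
             (if x + \<zeta>1 y = 0 then 1 / \<bar>(x + \<zeta>1 y)\<^sup>2 + \<zeta>2 y\<bar>
              else \<bar>\<alpha> (x, y)\<bar> / \<bar>x + \<zeta>1 y\<bar>) / sqrt (1 + (\<alpha> (x, y))\<^sup>2)))"

end

theory Submission
  imports Defs
begin

text \<open>Write \<open>A\<close> and \<open>g\<close> for the coefficients in \<open>X\<^sub>y = A J e\<^sub>1 + g T\<close>. In all three normal forms
  \<open>A = k x + m(y)\<close> with a constant \<open>k\<close> and \<open>g\<^sub>x = 2 A\<close>: up to the sign \<open>s = \<plusminus>1\<close> of the denominator of \<open>\<alpha>\<close>,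
  \<open>(A, g)\<close> is \<open>(x + \<zeta>\<^sub>1, (x + \<zeta>\<^sub>1)\<^sup>2)\<close>, \<open>s (1, 2 x + \<zeta>\<^sub>1)\<close> and \<open>s (x + \<zeta>\<^sub>1, (x + \<zeta>\<^sub>1)\<^sup>2 + \<zeta>\<^sub>2)\<close>, respectively.
  If \<open>e\<^sub>1\<close> has components \<open>(cos \<theta>, sin \<theta>)\<close> in the left invariant frame, then \<open>p\<close>-minimality says
  \<open>\<theta>\<^sub>x = 0\<close> and the equality of mixed derivatives of the horizontal projection of \<open>X\<close> gives
  \<open>\<theta>\<^sub>y = k\<close>; the condition \<open>g\<^sub>x = 2 A\<close> is the one remaining compatibility condition, for the
  vertical component. Taking \<open>\<theta> = k y\<close> and integrating yields an explicit surface. Conversely,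
  the angle between the frames of two surfaces with the same \<open>A\<close> and \<open>g\<close> is constant, and after
  the corresponding rotation the surfaces differ by a left translation.\<close>

section \<open>Calculus of smooth maps\<close>

text \<open>The congruence rule at level \<open>k\<close> is a premise because the congruence rule at level \<open>Suc k\<close>
  is itself proved with this lemma; \<open>Ck_on_derivI\<close> below discharges it.\<close>

lemma Ck_on_SucI:
  fixes f :: "'a::euclidean_space \<Rightarrow> 'b::euclidean_space"
  assumes "\<And>x. x \<in> S \<Longrightarrow> (f has_derivative D x) (at x)" "open S"
    and "\<And>v. Ck_on k (\<lambda>x. D x v) S"
    and cong: "\<And>(g :: 'a \<Rightarrow> 'b) h.
      (\<And>x. x \<in> S \<Longrightarrow> g x = h x) \<Longrightarrow> Ck_on k g S = Ck_on k h S"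
  shows "Ck_on (Suc k) f S"
proof -
  have "frechet_derivative f (at x) v = D x v" if "x \<in> S" for x v
    using assms(1)[OF that] by (metis frechet_derivative_at)
  then show ?thesis
    using assms(1,3) cong[of "\<lambda>x. frechet_derivative f (at x) v" "\<lambda>x. D x v" for v]
    by (auto simp: differentiable_def)
qed

lemma Ck_on_cong:
  fixes f g :: "'a::euclidean_space \<Rightarrow> 'b::euclidean_space"
  assumes "open S" "\<And>x. x \<in> S \<Longrightarrow> f x = g x"
  shows "Ck_on k f S = Ck_on k g S"
  using assms(2)
proof (induction k arbitrary: f g)
  case 0
  then show ?case by (simp cong: continuous_on_cong)
next
  case (Suc k)
  \<comment> \<open>The relation is symmetric, so one implication, stated for arbitrary functions,
    is applied in both directions at the end.\<close>
  have "Ck_on (Suc k) h S" if *: "Ck_on (Suc k) f S" "\<And>x. x \<in> S \<Longrightarrow> f x = h x" for f h :: "'a \<Rightarrow> 'b"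
  proof (rule Ck_on_SucI[OF _ assms(1)])
    fix x assume "x \<in> S"
    then have "(f has_derivative frechet_derivative f (at x)) (at x)"
      using * by (simp add: frechet_derivative_works)
    then show "(h has_derivative frechet_derivative f (at x)) (at x)"
      using \<open>x \<in> S\<close> * assms(1) by (metis has_derivative_transform_within_open)
  next
    show "Ck_on k (\<lambda>x. frechet_derivative f (at x) v) S" for v
      using * by simp
  qed (rule Suc.IH)
  from this[of f g] this[of g f] Suc.prems show ?case
    by metis
qed

lemmas Ck_on_derivI = Ck_on_SucI[OF _ _ _ Ck_on_cong]

text \<open>Level \<open>Suc k\<close> speaks only of the derivatives of \<open>f\<close>. The
  induction descends through them to level 0, where differentiability supplies continuity.\<close>

lemma Ck_on_SucD:
  assumes "Ck_on (Suc k) f S"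
  shows "Ck_on k f S"
  using assms
proof (induction k arbitrary: f)
  case 0
  then show ?case
    by (auto simp: differentiable_imp_continuous_within intro!: continuous_at_imp_continuous_on)
qed auto

lemma Ck_on_has_derivative:
  "Ck_on (Suc k) f S \<Longrightarrow> x \<in> S \<Longrightarrow> (f has_derivative frechet_derivative f (at x)) (at x)"
  by (simp add: frechet_derivative_works)

section \<open>Closure properties at finite order\<close>

lemma Ck_on_const: "open S \<Longrightarrow> Ck_on k (\<lambda>x. c) S"
proof (induction k arbitrary: c)
  case (Suc k)
  show ?case by (rule Ck_on_derivI[where D = "\<lambda>x v. 0"]) (use Suc in auto)
qed auto

lemma Ck_on_linear: "open S \<Longrightarrow> bounded_linear f \<Longrightarrow> Ck_on k f S"
proof (cases k)
  case (Suc l)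
  assume "open S" "bounded_linear f"
  then show ?thesis
    unfolding Suc
    by (intro Ck_on_derivI[where D = "\<lambda>x. f"])
      (auto intro: Ck_on_const bounded_linear_imp_has_derivative)
qed (auto intro: linear_continuous_on)

lemma Ck_on_add:
  "open S \<Longrightarrow> Ck_on k f S \<Longrightarrow> Ck_on k g S \<Longrightarrow> Ck_on k (\<lambda>x. f x + g x) S"
proof (induction k arbitrary: f g)
  case (Suc k)
  show ?case
    by (rule Ck_on_derivI[where D = "\<lambda>x v. frechet_derivative f (at x) v + frechet_derivative g (at x) v"])
      (use Suc in \<open>auto intro!: has_derivative_add simp: frechet_derivative_works[symmetric]\<close>)
qed (auto intro: continuous_on_add)

lemma Ck_on_mult:
  fixes f g :: "'a::euclidean_space \<Rightarrow> real"
  shows "open S \<Longrightarrow> Ck_on k f S \<Longrightarrow> Ck_on k g S \<Longrightarrow> Ck_on k (\<lambda>x. f x * g x) S"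
proof (induction k arbitrary: f g)
  case (Suc k)
  \<comment> \<open>The product rule keeps one factor undifferentiated, so the factors themselves
    are needed at level \<open>k\<close>.\<close>
  have "Ck_on k f S" "Ck_on k g S" using Suc.prems Ck_on_SucD by blast+
  then show ?case
    by (intro Ck_on_derivI[where D = "\<lambda>x v. f x * frechet_derivative g (at x) v + frechet_derivative f (at x) v * g x"])
      (use Suc in \<open>auto intro!: has_derivative_mult Ck_on_add simp: frechet_derivative_works[symmetric]\<close>)
qed (auto intro: continuous_on_mult)

lemma Ck_on_Pair:
  "open S \<Longrightarrow> Ck_on k f S \<Longrightarrow> Ck_on k g S \<Longrightarrow> Ck_on k (\<lambda>x. (f x, g x)) S"
proof (induction k arbitrary: f g)
  case (Suc k)
  show ?case
    by (rule Ck_on_derivI[where D = "\<lambda>x v. (frechet_derivative f (at x) v, frechet_derivative g (at x) v)"])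
      (use Suc in \<open>auto intro!: has_derivative_Pair simp: frechet_derivative_works[symmetric]\<close>)
qed (auto intro: continuous_on_Pair)

text \<open>The derivative of the composite in direction \<open>v\<close> is a derivative of
  \<open>f\<close> composed with the same \<open>L\<close>, so the induction varies only the outer
  function.\<close>

lemma Ck_on_compose_linear:
  assumes "open S" "bounded_linear L" "\<And>x. x \<in> S \<Longrightarrow> L x \<in> T"
  shows "Ck_on k f T \<Longrightarrow> Ck_on k (\<lambda>x. f (L x)) S"
proof (induction k arbitrary: f)
  case 0
  then show ?case
    using continuous_on_compose2[OF _ linear_continuous_on[OF assms(2)], of T f S] assms(3)
    by (simp add: image_subset_iff)
next
  case (Suc k)
  show ?case
  proof (rule Ck_on_derivI[where D = "\<lambda>x v. frechet_derivative f (at (L x)) (L v)"])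
    fix x assume "x \<in> S"
    then show "((\<lambda>x. f (L x)) has_derivative (\<lambda>v. frechet_derivative f (at (L x)) (L v))) (at x)"
      using has_derivative_compose[OF bounded_linear_imp_has_derivative[OF assms(2)]
          Ck_on_has_derivative[OF Suc.prems assms(3)]] by blast
  qed (use Suc assms in auto)
qed

section \<open>Smooth maps and primitives\<close>

lemma smooth_on_cong:
  assumes "open S" "\<And>x. x \<in> S \<Longrightarrow> f x = g x" "smooth_on f S"
  shows "smooth_on g S"
  using assms(3) Ck_on_cong[OF assms(1,2)] by (simp add: smooth_on_def)

lemma smooth_on_const: "open S \<Longrightarrow> smooth_on (\<lambda>x. c) S"
  by (simp add: smooth_on_def Ck_on_const)

lemma smooth_on_linear: "open S \<Longrightarrow> bounded_linear f \<Longrightarrow> smooth_on f S"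
  by (simp add: smooth_on_def Ck_on_linear)

lemma smooth_on_add:
  "open S \<Longrightarrow> smooth_on f S \<Longrightarrow> smooth_on g S \<Longrightarrow> smooth_on (\<lambda>x. f x + g x) S"
  by (simp add: smooth_on_def Ck_on_add)

lemma smooth_on_mult:
  fixes f g :: "'a::euclidean_space \<Rightarrow> real"
  shows "open S \<Longrightarrow> smooth_on f S \<Longrightarrow> smooth_on g S \<Longrightarrow> smooth_on (\<lambda>x. f x * g x) S"
  by (simp add: smooth_on_def Ck_on_mult)

lemma smooth_on_diff:
  fixes f g :: "'a::euclidean_space \<Rightarrow> real"
  assumes "open S" "smooth_on f S" "smooth_on g S"
  shows "smooth_on (\<lambda>x. f x - g x) S"
  using smooth_on_add[OF assms(1,2) smooth_on_mult[OF assms(1) smooth_on_const[of S "-1"] assms(3)]] assms(1)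
  by simp

lemma smooth_on_Pair:
  "open S \<Longrightarrow> smooth_on f S \<Longrightarrow> smooth_on g S \<Longrightarrow> smooth_on (\<lambda>x. (f x, g x)) S"
  by (simp add: smooth_on_def Ck_on_Pair)

lemma smooth_on_compose_linear:
  "open S \<Longrightarrow> bounded_linear L \<Longrightarrow> (\<And>x. x \<in> S \<Longrightarrow> L x \<in> T) \<Longrightarrow> smooth_on f T \<Longrightarrow>
    smooth_on (\<lambda>x. f (L x)) S"
  unfolding smooth_on_def using Ck_on_compose_linear by blast

lemma smooth_on_differentiable: "smooth_on f S \<Longrightarrow> x \<in> S \<Longrightarrow> f differentiable at x"
  using Ck_on.simps(2)[of 0 f S] by (auto simp: smooth_on_def simp del: Ck_on.simps)

lemma smooth_on_imp_continuous_on: "smooth_on f S \<Longrightarrow> continuous_on S f"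
  using Ck_on.simps(1)[of f S] by (auto simp: smooth_on_def simp del: Ck_on.simps)

lemma Ck_on_Suc_real:
  fixes F f :: "real \<Rightarrow> real"
  assumes "open S" "\<And>x. x \<in> S \<Longrightarrow> (F has_real_derivative f x) (at x)" "Ck_on k f S"
  shows "Ck_on (Suc k) F S"
  by (rule Ck_on_derivI[where D = "\<lambda>x v. f x * v"])
    (use assms in \<open>auto intro!: Ck_on_mult Ck_on_const simp: has_field_derivative_def\<close>)

text \<open>A primitive is one order better than its derivative; the surplus order is
  discarded.\<close>

lemma smooth_on_antiderivative:
  fixes F f :: "real \<Rightarrow> real"
  assumes "open S" "\<And>x. x \<in> S \<Longrightarrow> (F has_real_derivative f x) (at x)" "smooth_on f S"
  shows "smooth_on F S"
  unfolding smooth_on_def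
proof
  fix k
  show "Ck_on k F S"
    by (rule Ck_on_SucD[OF Ck_on_Suc_real]) (use assms in \<open>auto simp: smooth_on_def\<close>)
qed

lemma smooth_on_sin_cos:
  fixes k :: real
  assumes "open S"
  shows "smooth_on (\<lambda>y. sin (k * y)) S" "smooth_on (\<lambda>y. cos (k * y)) S"
proof -
  \<comment> \<open>Differentiation exchanges the two functions, hence a simultaneous
    induction.\<close>
  have "Ck_on j (\<lambda>y. sin (k * y)) S \<and> Ck_on j (\<lambda>y. cos (k * y)) S" for j
  proof (induction j)
    case 0
    then show ?case by (auto intro!: continuous_intros)
  next
    case (Suc j)
    have D: "Ck_on j (\<lambda>y. k * cos (k * y)) S" "Ck_on j (\<lambda>y. (- k) * sin (k * y)) S"
      using Suc by (intro Ck_on_mult Ck_on_const assms; simp)+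
    have "((\<lambda>y. sin (k * y)) has_real_derivative k * cos (k * y)) (at y)"
      "((\<lambda>y. cos (k * y)) has_real_derivative - k * sin (k * y)) (at y)" for y
      by (auto intro!: derivative_eq_intros)
    then show ?case
      using Ck_on_Suc_real[OF assms _ D(1)] Ck_on_Suc_real[OF assms _ D(2)] by simp
  qed
  then show "smooth_on (\<lambda>y. sin (k * y)) S" "smooth_on (\<lambda>y. cos (k * y)) S"
    by (auto simp: smooth_on_def)
qed

section \<open>The explicit surfaces\<close>

lemma snd_has_derivative:
  assumes "(f has_real_derivative d) (at (snd q))"
  shows "((\<lambda>r. f (snd r)) has_derivative (\<lambda>v. d * snd v)) (at q)"
  using has_derivative_compose[OF has_derivative_snd[OF has_derivative_ident]
      assms[unfolded has_field_derivative_def]] by simp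

text \<open>These are the coefficients that \<open>nabla\<close> differentiates for a field
  \<open>J e1\<close>; they turn out to be coordinates of \<open>e1\<close> up to sign.\<close>

lemma heis_J_components:
  "heis_metric p (heis_J p v) (frame1 p) = - fst (snd v)"
  "heis_metric p (heis_J p v) (frame2 p) = fst v"
  "heis_metric p (heis_J p v) (reeb p) = 0"
  by (cases p; cases v; simp add: reeb_def algebra_simps)+

section \<open>The surface and its derivative\<close>

text \<open>The curve \<open>(- P, Q, R)\<close> is the line \<open>x = 0\<close> of the surface.
  With \<open>e1\<close> at angle \<open>k * y\<close>, the derivative conditions say that its
  velocity is \<open>m J e1 + n T\<close>, which is the required \<open>X\<^sub>y\<close> at
  \<open>x = 0\<close>.\<close>

locale ruled_surface =
  fixes I :: "real set" and k :: real and m n P Q R :: "real \<Rightarrow> real"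
  assumes open_I: "open I"
    and smooth_m: "smooth_on m I" and smooth_n: "smooth_on n I"
    and P_deriv: "y \<in> I \<Longrightarrow> (P has_real_derivative m y * sin (k * y)) (at y)"
    and Q_deriv: "y \<in> I \<Longrightarrow> (Q has_real_derivative m y * cos (k * y)) (at y)"
    and R_deriv: "y \<in> I \<Longrightarrow>
      (R has_real_derivative n y - m y * (Q y * sin (k * y) - P y * cos (k * y))) (at y)"
begin

definition A :: "real \<times> real \<Rightarrow> real" where
  "A q = k * fst q + m (snd q)"

text \<open>The primitive of \<open>2 * A\<close> in the \<open>x\<close>-direction with value
  \<open>n\<close> at \<open>x = 0\<close>.\<close>

definition G :: "real \<times> real \<Rightarrow> real" where
  "G q = k * (fst q)\<^sup>2 + 2 * m (snd q) * fst q + n (snd q)"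

text \<open>For fixed \<open>y\<close> this is the straight line through the base point with frame
  coefficients \<open>(cos (k * y), sin (k * y))\<close>. Its vertical slope is constant because the
  moment of a planar line about the origin is constant along it.\<close>

definition X :: "real \<times> real \<Rightarrow> heis" where
  "X q = (fst q * cos (k * snd q) - P (snd q),
          fst q * sin (k * snd q) + Q (snd q),
          fst q * (Q (snd q) * cos (k * snd q) + P (snd q) * sin (k * snd q)) + R (snd q))"

text \<open>Closed form of the derivative, with the \<open>y\<close>-part already expressed through
  \<open>A\<close> and \<open>G\<close>; it agrees with \<open>frechet_derivative X\<close> where
  \<open>snd q \<in> I\<close>.\<close>

definition DX :: "real \<times> real \<Rightarrow> real \<times> real \<Rightarrow> heis" where
  "DX q v =
    (fst v * cos (k * snd q) - snd v * A q * sin (k * snd q),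
     fst v * sin (k * snd q) + snd v * A q * cos (k * snd q),
     fst v * (Q (snd q) * cos (k * snd q) + P (snd q) * sin (k * snd q)) +
       snd v * (G q - A q * (fst q + Q (snd q) * sin (k * snd q) - P (snd q) * cos (k * snd q))))"

lemma smooth_PQR: "smooth_on P I" "smooth_on Q I" "smooth_on R I"
proof -
  note sm = smooth_on_mult smooth_on_diff smooth_on_sin_cos open_I smooth_m smooth_n
  show P: "smooth_on P I"
    by (rule smooth_on_antiderivative[OF open_I P_deriv]) (assumption | intro sm)+
  show Q: "smooth_on Q I"
    by (rule smooth_on_antiderivative[OF open_I Q_deriv]) (assumption | intro sm)+
  show "smooth_on R I"
    by (rule smooth_on_antiderivative[OF open_I R_deriv]) (assumption | intro sm P Q)+
qed

lemma smooth_X: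
  assumes "open U" "U \<subseteq> UNIV \<times> I"
  shows "smooth_on X U"
proof -
  have snd: "smooth_on (\<lambda>q. f (snd q)) U" if "smooth_on f I" for f :: "real \<Rightarrow> real"
    by (rule smooth_on_compose_linear[OF assms(1) bounded_linear_snd _ that]) (use assms in auto)
  have fst: "smooth_on fst U"
    by (simp add: assms(1) bounded_linear_fst smooth_on_linear)
  show ?thesis
    unfolding X_def
    by (intro smooth_on_Pair smooth_on_add smooth_on_diff smooth_on_mult assms(1) fst
        snd[OF smooth_PQR(1)] snd[OF smooth_PQR(2)] snd[OF smooth_PQR(3)]
        snd[OF smooth_on_sin_cos(1)] snd[OF smooth_on_sin_cos(2)] open_I)
qed

lemma smooth_coord_dx:
  assumes "open U" "U \<subseteq> UNIV \<times> I"
  shows "smooth_on (\<lambda>q. DX q (1, 0)) U"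
proof -
  have snd: "smooth_on (\<lambda>q. f (snd q)) U" if "smooth_on f I" for f :: "real \<Rightarrow> real"
    by (rule smooth_on_compose_linear[OF assms(1) bounded_linear_snd _ that]) (use assms in auto)
  have "smooth_on (\<lambda>q. (cos (k * snd q), sin (k * snd q),
      Q (snd q) * cos (k * snd q) + P (snd q) * sin (k * snd q))) U"
    by (intro smooth_on_Pair smooth_on_add smooth_on_mult assms(1)
        snd[OF smooth_PQR(1)] snd[OF smooth_PQR(2)]
        snd[OF smooth_on_sin_cos(1)] snd[OF smooth_on_sin_cos(2)] open_I)
  then show ?thesis by (simp add: DX_def)
qed

lemma X_has_derivative:
  assumes "snd q \<in> I"
  shows "(X has_derivative DX q) (at q)"
proof -
  let ?y = "snd q"
  have "((\<lambda>y. sin (k * y)) has_real_derivative k * cos (k * ?y)) (at ?y)"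
    "((\<lambda>y. cos (k * y)) has_real_derivative - k * sin (k * ?y)) (at ?y)"
    by (auto intro!: derivative_eq_intros)
  note d = this[THEN snd_has_derivative] P_deriv[OF assms, THEN snd_has_derivative]
    Q_deriv[OF assms, THEN snd_has_derivative] R_deriv[OF assms, THEN snd_has_derivative]
  \<comment> \<open>The Pythagorean identity, oriented as a rewrite rule that brings trigonometric
    polynomials to a common form.\<close>
  have sq: "x * (cos (k * ?y))\<^sup>2 = x - x * (sin (k * ?y))\<^sup>2" for x
    by (simp add: cos_squared_eq algebra_simps)
  show ?thesis
    unfolding X_def
    by (rule derivative_eq_intros d refl)+
      (auto simp: DX_def A_def G_def fun_eq_iff algebra_simps power2_eq_square[symmetric] sq)
qed

lemma frechet_X: "snd q \<in> I \<Longrightarrow> frechet_derivative X (at q) = DX q"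
  using frechet_derivative_at[OF X_has_derivative] by simp

text \<open>Both \<open>e1\<close> and \<open>J e1\<close> are horizontal, so only the
  \<open>T\<close> coefficient of the \<open>y\<close>-derivative contributes. Points with
  \<open>G q \<noteq> 0\<close> are therefore regular.\<close>

lemma contact_form_DX: "contact_form (X q) (DX q v) = snd v * G q"
proof -
  have sq: "x * (cos (k * y))\<^sup>2 = x - x * (sin (k * y))\<^sup>2" for x y
    by (simp add: cos_squared_eq algebra_simps)
  show ?thesis
    by (simp add: X_def DX_def algebra_simps power2_eq_square[symmetric] sq)
qed

text \<open>Division by \<open>G q\<close> makes the \<open>T\<close> coefficient 1, which gives
  \<open>\<alpha> = A / G\<close>; no \<open>x\<close>-derivative is involved, so
  \<open>a = 0\<close>.\<close>

lemma DX_dy: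
  "DX q (0, 1) = A q *\<^sub>R heis_J (X q) (DX q (1, 0)) + G q *\<^sub>R reeb (X q)"
proof -
  have sq: "x * (cos (k * y))\<^sup>2 = x - x * (sin (k * y))\<^sup>2" for x y
    by (simp add: cos_squared_eq algebra_simps)
  show ?thesis
    by (simp add: X_def DX_def reeb_def algebra_simps power2_eq_square[symmetric] sq)
qed

text \<open>A horizontal tangent vector has no \<open>y\<close>-component because
  \<open>G q \<noteq> 0\<close>, and the \<open>x\<close>-derivative has unit length. Only its two
  signs remain as characteristic directions.\<close>

lemma DX_horizontal_unit:
  assumes "G q \<noteq> 0" "contact_form (X q) (DX q v) = 0"
    "heis_metric (X q) (DX q v) (DX q v) = 1"
  shows "snd v = 0" "fst v * fst v = 1"
proof -
  show v: "snd v = 0" using assms by (simp add: contact_form_DX)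
  obtain a b c where abc: "DX q v = (a, b, c)" by (cases "DX q v")
  have "a * a + b * b = 1"
    using assms(2,3) unfolding abc by simp
  moreover have "a = fst v * cos (k * snd q)" "b = fst v * sin (k * snd q)"
    using abc v by (simp_all add: DX_def)
  ultimately show "fst v * fst v = 1"
    using sin_cos_squared_add[of "k * snd q"] by algebra
qed

section \<open>Minimality, regularity and compatible coordinates\<close>

text \<open>A characteristic field is the \<open>x\<close>-derivative up to a locally constant sign.
  Its frame coefficients thus depend locally on \<open>y\<close> alone, and \<open>J e1\<close> is
  parallel along \<open>e1\<close>.\<close>

lemma p_minimal_X:
  assumes U: "open U" "U \<subseteq> UNIV \<times> I" and G: "\<And>q. q \<in> U \<Longrightarrow> G q \<noteq> 0"
  shows "p_minimal U X"
  unfolding p_minimal_def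
proof (intro allI impI ballI, elim conjE)
  fix W e1 q assume W: "open W" "W \<subseteq> U" "characteristic_field W X e1" "q \<in> W"
  \<comment> \<open>The sign of \<open>e1\<close> relative to the \<open>x\<close>-derivative,
    written as an inner product so that it inherits continuity from \<open>e1\<close>.\<close>
  define h where "h r = fst (e1 r) * cos (k * snd r) + fst (snd (e1 r)) * sin (k * snd r)" for r
  have e1: "e1 r = DX r (h r, 0) \<and> h r * h r = 1" if "r \<in> W" for r
  proof -
    have r: "snd r \<in> I" "G r \<noteq> 0" using that W(2) U(2) G by auto
    have "e1 r \<in> range (DX r)" "contact_form (X r) (e1 r) = 0" "heis_metric (X r) (e1 r) (e1 r) = 1"
      using W(3) that r
      by (auto simp: characteristic_field_def tangent_plane_def contact_plane_def frechet_X)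
    then obtain v where v: "e1 r = DX r v" "contact_form (X r) (DX r v) = 0"
      "heis_metric (X r) (DX r v) (DX r v) = 1"
      by force
    have "snd v = 0" "fst v * fst v = 1" using DX_horizontal_unit[OF r(2) v(2,3)] by auto
    moreover from this have "h r = fst v * cos (k * snd r) * cos (k * snd r) +
        fst v * sin (k * snd r) * sin (k * snd r)"
      by (simp add: h_def v(1) DX_def)
    then have "h r = fst v"
      using sin_cos_squared_add[of "k * snd r"] by algebra
    ultimately show ?thesis using v(1) by (cases v) auto
  qed
  have "continuous_on W e1"
    using W(3) smooth_on_imp_continuous_on by (auto simp: characteristic_field_def)
  then have cont: "continuous_on W (\<lambda>r. h r * h q)"
    unfolding h_def by (intro continuous_intros)
  \<comment> \<open>\<open>W\<close> may be disconnected, so the sign is frozen only on a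
    neighbourhood of \<open>q\<close>.\<close>
  define N where "N = {r \<in> W. 0 < h r * h q}"
  have "open N"
    using continuous_open_preimage[OF cont W(1) open_greaterThan[of 0]]
    by (rule back_subst[where P = "open"]) (auto simp: N_def)
  have "q \<in> N" using e1[OF W(4)] W(4) by (simp add: N_def)
  have h: "h r = h q" if "r \<in> N" for r
  proof -
    have "(h r - h q) * (h r + h q) = 0"
      using e1[of r] e1[of q] W(4) that by (simp add: N_def algebra_simps)
    then show ?thesis using that by (auto simp: N_def add_eq_0_iff mult_less_0_iff not_less)
  qed
  have cs: "((\<lambda>r. - (h q * sin (k * snd r))) has_derivative (\<lambda>v. - h q * k * cos (k * snd q) * snd v)) (at q)"
    "((\<lambda>r. h q * cos (k * snd r)) has_derivative (\<lambda>v. - h q * k * sin (k * snd q) * snd v)) (at q)"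
    by (auto intro!: derivative_eq_intros)
  have loc: "- fst (snd (e1 r)) = - (h q * sin (k * snd r))" "fst (e1 r) = h q * cos (k * snd r)"
    if "r \<in> N" for r
    using e1[of r] h[OF that] that by (simp_all add: N_def DX_def)
  have d: "frechet_derivative (\<lambda>r. - fst (snd (e1 r))) (at q) (h q, 0) = 0"
    "frechet_derivative (\<lambda>r. fst (e1 r)) (at q) (h q, 0) = 0"
    using has_derivative_transform_within_open[OF cs(1) \<open>open N\<close> \<open>q \<in> N\<close> loc(1)[symmetric],
        THEN frechet_derivative_at, symmetric]
      has_derivative_transform_within_open[OF cs(2) \<open>open N\<close> \<open>q \<in> N\<close> loc(2)[symmetric],
        THEN frechet_derivative_at, symmetric]
    by simp_all
  have "nabla X (\<lambda>r. heis_J (X r) (e1 r)) q (h q, 0) = 0"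
    by (simp add: nabla_def heis_J_components d)
  moreover have "frechet_derivative X (at q) (h q, 0) = e1 q"
    using e1[OF W(4)] W(2,4) U(2) by (subst frechet_X) auto
  ultimately show "has_p_mean_curvature X e1 q 0"
    unfolding has_p_mean_curvature_def by auto
qed

lemma p_minimal_regular_X:
  assumes U: "open U" "U \<subseteq> UNIV \<times> I" and G: "\<And>q. q \<in> U \<Longrightarrow> G q > 0"
  shows "p_minimal_regular U X"
proof -
  have "\<not> singular_point X q" if "q \<in> U" for q
  proof
    assume "singular_point X q"
    moreover have "snd q \<in> I" using that U by auto
    ultimately have "DX q (0, 1) \<in> contact_plane (X q)"
      by (auto simp: singular_point_def tangent_plane_def frechet_X)
    then show False
      using G[OF that] by (simp add: contact_plane_def contact_form_DX)
  qed
  then show ?thesis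
    using p_minimal_X[OF U] G by (force simp: p_minimal_regular_def)
qed

lemma compatible_coordinates_X:
  assumes U: "open U" "U \<subseteq> UNIV \<times> I" and G: "\<And>q. q \<in> U \<Longrightarrow> G q > 0"
  shows "compatible_coordinates U X (\<lambda>q. A q / G q) (\<lambda>q. 0)
    (\<lambda>q. 1 / G q / sqrt (1 + (A q / G q)\<^sup>2))"
proof -
  have I: "snd q \<in> I" if "q \<in> U" for q using that U by auto
  have dx: "coord_dx X q = DX q (1, 0)" and dy: "coord_dy X q = DX q (0, 1)" if "q \<in> U" for q
    using that by (simp_all add: coord_dx_def coord_dy_def frechet_X I)
  \<comment> \<open>Exhibiting the preimage \<open>(0, 1 / G q)\<close> settles both tangency and
    the coefficients of \<open>e2_hat\<close>.\<close>
  have e2: "(A q / G q) *\<^sub>R heis_J (X q) (coord_dx X q) + reeb (X q) = DX q (0, 1 / G q)"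
    if "q \<in> U" for q
  proof -
    have "DX q (0, 1 / G q) = (1 / G q) *\<^sub>R DX q (0, 1)"
      by (simp add: DX_def algebra_simps)
    then show ?thesis
      using G[OF that] by (simp add: dx that DX_dy scaleR_add_right)
  qed
  have "characteristic_field U X (coord_dx X)"
    unfolding characteristic_field_def
  proof (intro conjI ballI IntI)
    show "smooth_on (coord_dx X) U"
      using smooth_on_cong[OF U(1) _ smooth_coord_dx[OF U]] dx by auto
    fix q assume q: "q \<in> U"
    show "coord_dx X q \<in> tangent_plane X q"
      by (simp add: tangent_plane_def coord_dx_def)
    show *: "coord_dx X q \<in> contact_plane (X q)"
      using q by (simp add: dx contact_plane_def contact_form_DX)
    obtain a b c where abc: "DX q (1, 0) = (a, b, c)" by (cases "DX q (1, 0)")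
    then have "a = cos (k * snd q)" "b = sin (k * snd q)" by (auto simp: DX_def)
    then show "heis_metric (X q) (coord_dx X q) (coord_dx X q) = 1"
      using * q abc by (simp add: dx contact_plane_def flip: power2_eq_square)
  qed
  moreover have "is_alpha_function U X (coord_dx X) (\<lambda>q. A q / G q)"
    by (auto simp: is_alpha_function_def e2 tangent_plane_def frechet_X I)
  moreover have "e2_hat X (coord_dx X) (\<lambda>q. A q / G q) q =
      (1 / G q / sqrt (1 + (A q / G q)\<^sup>2)) *\<^sub>R coord_dy X q" if "q \<in> U" for q
  proof -
    have "DX q (0, 1 / G q) = (1 / G q) *\<^sub>R DX q (0, 1)"
      by (simp add: DX_def algebra_simps)
    then show ?thesis
      using that by (simp add: e2_hat_def e2 dy)
  qed
  ultimately show ?thesis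
    unfolding compatible_coordinates_def
    using G by (auto simp: add_pos_nonneg intro!: mult_pos_pos)
qed

section \<open>Passage to an embedded neighbourhood\<close>

text \<open>\<open>A > 0\<close> makes the horizontal projection locally invertible, and
  \<open>G > 0\<close> gives regularity and \<open>b > 0\<close>.\<close>

lemma open_positive:
  "open {q \<in> UNIV \<times> I. A q > 0 \<and> G q > 0}"
proof -
  have o: "open (UNIV \<times> I :: (real \<times> real) set)" by (simp add: open_I open_Times)
  have c: "continuous_on (UNIV \<times> I) (\<lambda>q::real \<times> real. f (snd q))" if "smooth_on f I" for f :: "real \<Rightarrow> real"
    by (rule continuous_on_compose2[OF smooth_on_imp_continuous_on[OF that]])
      (auto intro: continuous_intros)
  have "continuous_on (UNIV \<times> I) A" "continuous_on (UNIV \<times> I) G"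
    unfolding A_def G_def by (intro continuous_intros c smooth_m smooth_n)+
  then have "open ((UNIV \<times> I \<inter> A -` {0<..}) \<inter> (UNIV \<times> I \<inter> G -` {0<..}))"
    by (intro open_Int[OF continuous_open_preimage continuous_open_preimage] o open_greaterThan)
  then show ?thesis by (rule back_subst[where P = "open"]) auto
qed

text \<open>The horizontal projection of \<open>X\<close> has Jacobian \<open>A\<close>, so it is already a local
  homeomorphism where \<open>A \<noteq> 0\<close>, and its inverse provides one for \<open>X\<close>.\<close>

lemma local_homeomorphism_X:
  assumes "open S" "S \<subseteq> UNIV \<times> I" "q0 \<in> S" "A q0 \<noteq> 0"
  obtains U g where "open U" "U \<subseteq> S" "q0 \<in> U" "homeomorphism U (X ` U) X g"
proof -
  define F where "F q = (fst (X q), fst (snd (X q)))" for q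
  define D where "D q v = (fst (DX q v), fst (snd (DX q v)))" for q v
  \<comment> \<open>\<open>D q0\<close> stretches the second coordinate by \<open>A q0\<close> and
    then rotates by \<open>k * snd q0\<close>; this undoes both.\<close>
  define inv0 where "inv0 w =
    (fst w * cos (k * snd q0) + snd w * sin (k * snd q0),
     (snd w * cos (k * snd q0) - fst w * sin (k * snd q0)) / A q0)" for w
  have D: "(F has_derivative D q) (at q)" if "q \<in> S" for q
    unfolding F_def D_def
    using that assms(2) by (auto intro!: derivative_eq_intros X_has_derivative)
  have bl: "bounded_linear (D q)" for q
    unfolding D_def DX_def by (auto intro!: bounded_linear_intros simp: mult.commute)
  have bl0: "bounded_linear inv0"
    unfolding inv0_def divide_inverse by (intro bounded_linear_intros)
  have "inv0 (D q0 v) = v" for v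
  proof -
    have sq: "x * (cos (k * y))\<^sup>2 = x - x * (sin (k * y))\<^sup>2" for x y
      by (simp add: cos_squared_eq algebra_simps)
    show ?thesis
      using assms(4)
      by (cases v) (simp add: D_def DX_def inv0_def field_simps power2_eq_square[symmetric] sq)
  qed
  then have inv: "Blinfun inv0 o\<^sub>L Blinfun (D q0) = id_blinfun"
    by (intro blinfun_eqI) (simp add: bounded_linear_Blinfun_apply bl bl0)
  have c: "continuous_on S (\<lambda>q. m (snd q))"
    by (rule continuous_on_compose2[OF smooth_on_imp_continuous_on[OF smooth_m]])
      (use assms(2) in \<open>auto intro: continuous_intros\<close>)
  have cont: "continuous_on S (\<lambda>q. Blinfun (D q))"
    by (rule continuous_on_blinfun_componentwise)
      (auto simp: bounded_linear_Blinfun_apply bl D_def DX_def A_def intro!: continuous_intros c)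
  have "(F has_derivative blinfun_apply (Blinfun (D q))) (at q)" if "q \<in> S" for q
    using D[OF that] by (simp add: bounded_linear_Blinfun_apply bl)
  from inverse_function_theorem[OF assms(1) this cont assms(3) inv]
  obtain U V g where U: "open U" "U \<subseteq> S" "q0 \<in> U" and hom: "homeomorphism U V F g"
    by metis
  have gF: "g (F q) = q" if "q \<in> U" for q
    using hom that by (auto simp: homeomorphism_def)
  have "homeomorphism U (X ` U) X (\<lambda>p. g (fst p, fst (snd p)))"
  proof (rule homeomorphismI)
    show "continuous_on U X"
      using smooth_on_imp_continuous_on smooth_X U assms(2) by blast
    have V: "V = F ` U" "continuous_on V g" using hom by (auto simp: homeomorphism_def)
    show "continuous_on (X ` U) (\<lambda>p. g (fst p, fst (snd p)))"
      by (rule continuous_on_compose2[OF V(2), of _ "\<lambda>p. (fst p, fst (snd p))"])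
        (auto simp: V(1) F_def intro!: continuous_intros imageI)
  qed (use gF in \<open>auto simp: F_def\<close>)
  with U show thesis by (rule that)
qed

lemma exists_neighborhood_X:
  assumes "snd q0 \<in> I" "A q0 > 0" "G q0 > 0"
  obtains U where "coordinate_neighborhood U" "U \<subseteq> UNIV \<times> I" "embedding U X"
    "p_minimal_regular U X"
    "compatible_coordinates U X (\<lambda>q. A q / G q) (\<lambda>q. 0)
      (\<lambda>q. 1 / G q / sqrt (1 + (A q / G q)\<^sup>2))"
    "\<And>q. q \<in> U \<Longrightarrow> A q > 0 \<and> G q > 0"
proof -
  let ?S = "{q \<in> UNIV \<times> I. A q > 0 \<and> G q > 0}"
  have "q0 \<in> ?S" using assms by (cases q0) auto
  then obtain V g where V: "open V" "V \<subseteq> ?S" "q0 \<in> V" and hom: "homeomorphism V (X ` V) X g"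
    using local_homeomorphism_X[OF open_positive, of q0] assms by (metis (no_types, lifting) less_irrefl mem_Collect_eq subsetI)
  \<comment> \<open>A ball is connected, as a coordinate neighborhood must be, and the homeomorphism
    restricts to it.\<close>
  then obtain r where r: "r > 0" "ball q0 r \<subseteq> V" using open_contains_ball by blast
  define U where "U = ball q0 r"
  have US: "U \<subseteq> ?S" using r V by (auto simp: U_def)
  then have U: "open U" "U \<subseteq> UNIV \<times> I" "\<And>q. q \<in> U \<Longrightarrow> G q > 0"
    by (auto simp: U_def)
  have "inj (DX q)" if "q \<in> U" for q
  proof -
    have "v = 0" if "DX q v = 0" for v
    proof -
      have "snd v * G q = 0"
        using contact_form_DX[of q v] that by (cases "X q") (simp add: zero_prod_def)
      then have v: "snd v = 0" using U(3)[OF \<open>q \<in> U\<close>] by simp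
      then have "fst v * cos (k * snd q) = 0" "fst v * sin (k * snd q) = 0"
        using that by (simp_all add: DX_def zero_prod_def)
      then have "fst v = 0" using sin_cos_squared_add[of "k * snd q"] by algebra
      with v show "v = 0" by (simp add: prod_eq_iff)
    qed
    moreover have "linear (DX q)"
      using has_derivative_linear[OF X_has_derivative[of q]] U(2) \<open>q \<in> U\<close> by auto
    ultimately show ?thesis by (simp add: linear_injective_0)
  qed
  moreover have "homeomorphism U (X ` U) X g"
    using homeomorphism_of_subsets[OF hom _ image_mono refl] r by (simp add: U_def)
  ultimately have "embedding U X"
    unfolding embedding_def using smooth_X[OF U(1,2)] U(2) by (auto simp: frechet_X subset_iff)
  moreover have "coordinate_neighborhood U"
    using r by (simp add: U_def coordinate_neighborhood_def)
  ultimately show thesis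
    using that[of U] p_minimal_regular_X[OF U] compatible_coordinates_X[OF U] U US by auto
qed

end

section \<open>Existence for given coefficients\<close>

lemma ruled_surface_exists:
  fixes c d :: ereal
  assumes "c < d" "smooth_on m (einterval c d)" "smooth_on n (einterval c d)"
  obtains P Q R where "ruled_surface (einterval c d) k m n P Q R"
proof -
  have prim: "\<exists>F. \<forall>y\<in>einterval c d. (F has_real_derivative f y) (at y)"
    if "continuous_on (einterval c d) f" for f :: "real \<Rightarrow> real"
  proof -
    have "isCont f x" if "c < ereal x" "ereal x < d" for x
      using \<open>continuous_on (einterval c d) f\<close> that
      by (simp add: continuous_on_eq_continuous_at einterval_iff)
    from einterval_antiderivative[OF assms(1) this] show ?thesis
      by (simp add: Ball_def einterval_iff imp_conjL has_real_derivative_iff_has_vector_derivative)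
  qed
  note cont = assms(2,3)[THEN smooth_on_imp_continuous_on]
  have cs: "continuous_on S (\<lambda>y. sin (k * y))" "continuous_on S (\<lambda>y. cos (k * y))" for S
    by (auto intro!: continuous_intros)
  obtain P where P: "\<And>y. y \<in> einterval c d \<Longrightarrow> (P has_real_derivative m y * sin (k * y)) (at y)"
    using prim[OF continuous_on_mult[OF cont(1) cs(1)]] by blast
  obtain Q where Q: "\<And>y. y \<in> einterval c d \<Longrightarrow> (Q has_real_derivative m y * cos (k * y)) (at y)"
    using prim[OF continuous_on_mult[OF cont(1) cs(2)]] by blast
  \<comment> \<open>The integrand for \<open>R\<close> contains \<open>P\<close> and
    \<open>Q\<close>, so these are constructed first.\<close>
  have "continuous_on (einterval c d) P" "continuous_on (einterval c d) Q"
    using P Q by (auto intro!: continuous_at_imp_continuous_on DERIV_isCont)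
  then have "continuous_on (einterval c d) (\<lambda>y. n y - m y * (Q y * sin (k * y) - P y * cos (k * y)))"
    by (intro continuous_intros cont)
  then obtain R where R: "\<And>y. y \<in> einterval c d \<Longrightarrow>
      (R has_real_derivative n y - m y * (Q y * sin (k * y) - P y * cos (k * y))) (at y)"
    using prim by blast
  show thesis
    by (rule that, unfold_locales) (use P Q R assms in auto)
qed

text \<open>Common source of the three existence results, which differ only in \<open>k\<close>,
  \<open>m\<close>, \<open>n\<close> and in the base point \<open>(x0, y0)\<close> where positivity
  is checked.\<close>

lemma exists_normal_surface:
  fixes c d :: ereal and k :: real
  assumes "c < d" "smooth_on m (einterval c d)" "smooth_on n (einterval c d)"
    and "y0 \<in> einterval c d" "k * x0 + m y0 > 0" "k * x0\<^sup>2 + 2 * m y0 * x0 + n y0 > 0"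
  obtains U X where "coordinate_neighborhood U" "U \<subseteq> UNIV \<times> einterval c d" "embedding U X"
    "p_minimal_regular U X"
    "\<And>x y. (x, y) \<in> U \<Longrightarrow> k * x + m y > 0 \<and> k * x\<^sup>2 + 2 * m y * x + n y > 0"
    "compatible_coordinates U X
       (\<lambda>(x, y). (k * x + m y) / (k * x\<^sup>2 + 2 * m y * x + n y)) (\<lambda>q. 0)
       (\<lambda>(x, y). 1 / (k * x\<^sup>2 + 2 * m y * x + n y) /
          sqrt (1 + ((k * x + m y) / (k * x\<^sup>2 + 2 * m y * x + n y))\<^sup>2))"
proof -
  obtain P Q R where "ruled_surface (einterval c d) k m n P Q R"
    using ruled_surface_exists assms(1-3) by blast
  then interpret ruled_surface "einterval c d" k m n P Q R .
  obtain U where U: "coordinate_neighborhood U" "U \<subseteq> UNIV \<times> einterval c d" "embedding U X"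
    "p_minimal_regular U X"
    "compatible_coordinates U X (\<lambda>q. A q / G q) (\<lambda>q. 0)
      (\<lambda>q. 1 / G q / sqrt (1 + (A q / G q)\<^sup>2))"
    "\<And>q. q \<in> U \<Longrightarrow> A q > 0 \<and> G q > 0"
    by (rule exists_neighborhood_X[of "(x0, y0)"]) (use assms in \<open>auto simp: A_def G_def\<close>)
  show thesis
    by (rule that[of U X]) (use U in \<open>force simp: A_def G_def case_prod_unfold\<close>)+
qed

section \<open>Congruence\<close>

text \<open>The rotation about the vertical axis with cosine \<open>D\<close> and sine
  \<open>E\<close>, followed by left translation by \<open>(a, b, c)\<close>.\<close>

definition rotation_translation :: "real \<Rightarrow> real \<Rightarrow> real \<Rightarrow> real \<Rightarrow> real \<Rightarrow> heis \<Rightarrow> heis" where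
  "rotation_translation D E a b c = (\<lambda>(u, v, w).
     (D * u - E * v + a, E * u + D * v + b, w + b * (D * u - E * v) - a * (E * u + D * v) + c))"

text \<open>Rotations are group automorphisms, so the inverse is again of this shape: the opposite
  rotation, with \<open>(- a, - b)\<close> rotated back as its horizontal translation.\<close>

lemma rotation_translation_inverse:
  assumes "D\<^sup>2 + E\<^sup>2 = 1"
  shows "rotation_translation D (- E) (- (D * a + E * b)) (E * a - D * b) (- c)
    (rotation_translation D E a b c p) = p"
proof -
  obtain u v w where p: "p = (u, v, w)" by (cases p)
  show ?thesis
    unfolding p rotation_translation_def prod.case prod.inject
    using assms by (intro conjI; algebra)
qed

lemma rotation_translation_derivative:
  "(rotation_translation D E a b c has_derivative
    (\<lambda>(u, v, w). (D * u - E * v, E * u + D * v, w + b * (D * u - E * v) - a * (E * u + D * v)))) (at p)"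
  unfolding rotation_translation_def case_prod_unfold
  by (auto intro!: derivative_eq_intros)

lemma smooth_rotation_translation: "smooth_on (rotation_translation D E a b c) UNIV"
proof -
  have "rotation_translation D E a b c = (\<lambda>p.
      (\<lambda>(u, v, w). (D * u - E * v, E * u + D * v, w + b * (D * u - E * v) - a * (E * u + D * v))) p
      + (a, b, c))"
    by (auto simp: rotation_translation_def)
  moreover have "smooth_on \<dots> UNIV"
    by (intro smooth_on_add smooth_on_linear smooth_on_const open_UNIV
        has_derivative_bounded_linear[OF rotation_translation_derivative])
  ultimately show ?thesis by simp
qed

lemma rigid_motion_rotation_translation:
  assumes "D\<^sup>2 + E\<^sup>2 = 1"
  shows "rigid_motion (rotation_translation D E a b c)" (is "rigid_motion ?\<Phi>")
proof -
  let ?\<Psi> = "rotation_translation D (- E) (- (D * a + E * b)) (E * a - D * b) (- c)"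
  have 1: "?\<Psi> (?\<Phi> p) = p" for p
    by (rule rotation_translation_inverse[OF assms])
  \<comment> \<open>Inverting the parameters twice returns \<open>a\<close> and \<open>b\<close>, so
    the left inverse is also a right inverse.\<close>
  have "- (D * - (D * a + E * b) + - E * (E * a - D * b)) = (D\<^sup>2 + E\<^sup>2) * a"
    "- E * - (D * a + E * b) - D * (E * a - D * b) = (D\<^sup>2 + E\<^sup>2) * b"
    by (simp_all add: power2_eq_square algebra_simps)
  then have 2: "?\<Phi> (?\<Psi> p) = p" for p
    using rotation_translation_inverse[of D "- E" "- (D * a + E * b)" "E * a - D * b" "- c" p] assms
    by simp
  have bij: "bij ?\<Phi>" using 1 2 by (metis bijI')
  have inv: "inv ?\<Phi> = ?\<Psi>" using 1 2 by (metis inv_equality)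
  have F: "frechet_derivative ?\<Phi> (at p) =
      (\<lambda>(u, v, w). (D * u - E * v, E * u + D * v, w + b * (D * u - E * v) - a * (E * u + D * v)))" for p
    using frechet_derivative_at[OF rotation_translation_derivative] by metis
  have contact: "contact_form (?\<Phi> p) (frechet_derivative ?\<Phi> (at p) v) = contact_form p v" for p v
  proof -
    obtain p1 p2 p3 v1 v2 v3 where [simp]: "p = (p1, p2, p3)" "v = (v1, v2, v3)"
      by (cases p, cases v)
    show ?thesis
      unfolding F unfolding rotation_translation_def using assms by simp algebra
  qed
  have "frechet_derivative ?\<Phi> (at p) (heis_J p v) = heis_J (?\<Phi> p) (frechet_derivative ?\<Phi> (at p) v)"
    for p v
  proof -
    obtain p1 p2 p3 v1 v2 v3 where [simp]: "p = (p1, p2, p3)" "v = (v1, v2, v3)"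
      by (cases p, cases v)
    show ?thesis
      unfolding F unfolding rotation_translation_def using assms by simp algebra
  qed
  with contact show ?thesis
    by (simp add: rigid_motion_def bij inv smooth_rotation_translation)
qed

section \<open>Derivatives along coordinate lines\<close>

lemma constant_along_x:
  fixes f :: "real \<times> real \<Rightarrow> real"
  assumes "\<And>x. x \<in> {x0..x1} \<Longrightarrow> (f has_derivative Df x) (at (x, y))"
    and "\<And>x. x \<in> {x0..x1} \<Longrightarrow> Df x (1, 0) = 0" and "x \<in> {x0..x1}" "x' \<in> {x0..x1}"
  shows "f (x, y) = f (x', y)"
proof -
  have "((\<lambda>t. f (t, y)) has_field_derivative 0) (at t within {x0..x1})" if t: "t \<in> {x0..x1}" for t
  proof -
    have "((\<lambda>t. (t, y)) has_derivative (\<lambda>h. (h, 0))) (at t)"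
      by (auto intro!: derivative_eq_intros)
    from has_derivative_compose[OF this assms(1)[OF t]]
    have "((\<lambda>t. f (t, y)) has_derivative (\<lambda>h. Df t (h, 0))) (at t)" .
    moreover have "Df t (h, 0) = 0" for h
      using linear_scale[OF has_derivative_linear[OF assms(1)[OF t]], of h "(1, 0)"] assms(2)[OF t]
      by simp
    ultimately show ?thesis
      by (simp add: has_field_derivative_def has_derivative_at_withinI mult_zero_left[abs_def])
  qed
  from has_field_derivative_zero_constant[OF _ this] assms(3,4) show ?thesis by force
qed

text \<open>Since \<open>h\<close> does not depend on \<open>x\<close>, it is a difference quotient of \<open>f\<close> in the \<open>x\<close>-direction;
  this replaces the symmetry of the second derivatives of \<open>f\<close>.\<close>

lemma mixed_derivative:
  fixes f h s :: "real \<times> real \<Rightarrow> real"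
  assumes "open U" "(x0, y0) \<in> U"
    and f: "\<And>q. q \<in> U \<Longrightarrow> (f has_derivative Df q) (at q)"
    and h: "\<And>q. q \<in> U \<Longrightarrow> (h has_derivative Dh q) (at q)"
    and s: "\<And>q. q \<in> U \<Longrightarrow> (s has_derivative Ds q) (at q)"
    and dx: "\<And>q. q \<in> U \<Longrightarrow> Df q (1, 0) = h q"
      "\<And>q. q \<in> U \<Longrightarrow> Dh q (1, 0) = 0" "\<And>q. q \<in> U \<Longrightarrow> Ds q (1, 0) = 0"
    and dy: "\<And>x y. (x, y) \<in> U \<Longrightarrow> Df (x, y) (0, 1) = (k * x + m y) * s (x, y)"
  shows "Dh (x0, y0) (0, 1) = k * s (x0, y0)"
proof -
  obtain S T where ST: "open S" "open T" "(x0, y0) \<in> S \<times> T" "S \<times> T \<subseteq> U"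
    using open_prod_elim[OF assms(1,2)] by metis
  obtain e where e: "e > 0" "cball x0 e \<subseteq> S"
    using ST(1,3) open_contains_cball by blast
  define x1 where "x1 = x0 + e"
  have in_U: "(x, y) \<in> U" if "x \<in> {x0..x1}" "y \<in> T" for x y
    using that e ST(4) by (auto simp: x1_def dist_real_def subset_iff)
  have x01: "x0 \<in> {x0..x1}" "x1 \<in> {x0..x1}" using e by (auto simp: x1_def)
  \<comment> \<open>On the segment from \<open>x0\<close> to \<open>x1\<close>, \<open>f\<close> has
    constant \<open>x\<close>-slope \<open>h (x0, y)\<close>, so subtracting
    \<open>fst q * h (x0, y)\<close> leaves a function constant in \<open>x\<close>.\<close>
  have quot: "h (x0, y) = (f (x1, y) - f (x0, y)) / e" if y: "y \<in> T" for y
  proof -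
    have "f (x1, y) - fst (x1, y) * h (x0, y) = f (x0, y) - fst (x0, y) * h (x0, y)"
    proof (rule constant_along_x[where f = "\<lambda>q. f q - fst q * h (x0, y)"])
      fix x assume x: "x \<in> {x0..x1}"
      show "((\<lambda>q. f q - fst q * h (x0, y)) has_derivative
          (\<lambda>v. Df (x, y) v - fst v * h (x0, y))) (at (x, y))"
        by (auto intro!: derivative_eq_intros f in_U x y)
      have "h (x, y) = h (x0, y)"
        by (rule constant_along_x[of x0 x1 h "\<lambda>x. Dh (x, y)"]) (use h dx(2) in_U x x01 y in auto)
      then show "Df (x, y) (1, 0) - fst (1, 0) * h (x0, y) = 0"
        using dx(1)[OF in_U[OF x y]] by simp
    qed (use x01 in auto)
    then show ?thesis using e by (simp add: x1_def field_simps)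
  qed
  have y0: "y0 \<in> T" using ST by auto
  have vertical: "((\<lambda>y. F (x, y)) has_derivative (\<lambda>t. DF (0, t))) (at y0)"
    if "(F has_derivative DF) (at (x, y0))" for F :: "real \<times> real \<Rightarrow> real" and DF x
  proof -
    have "((\<lambda>y. (x, y)) has_derivative (\<lambda>t. (0, t))) (at y0)"
      by (auto intro!: derivative_eq_intros)
    from has_derivative_compose[OF this that] show ?thesis .
  qed
  have "((\<lambda>y. (f (x1, y) - f (x0, y)) / e) has_derivative
      (\<lambda>t. (Df (x1, y0) (0, t) - Df (x0, y0) (0, t)) / e)) (at y0)"
    unfolding divide_inverse
    by (intro has_derivative_mult_left has_derivative_diff vertical f in_U x01 y0)
  then have "((\<lambda>y. h (x0, y)) has_derivative
      (\<lambda>t. (Df (x1, y0) (0, t) - Df (x0, y0) (0, t)) / e)) (at y0)"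
    by (rule has_derivative_transform_within_open[OF _ ST(2) y0]) (simp add: quot)
  then have "(\<lambda>t. Dh (x0, y0) (0, t)) = (\<lambda>t. (Df (x1, y0) (0, t) - Df (x0, y0) (0, t)) / e)"
    using vertical[OF h[OF in_U[OF x01(1) y0]]] has_derivative_unique by blast
  then have "Dh (x0, y0) (0, 1) = (Df (x1, y0) (0, 1) - Df (x0, y0) (0, 1)) / e"
    by metis
  \<comment> \<open>With equal values of \<open>s\<close> at both ends the \<open>m\<close> terms
    cancel, and the difference of the \<open>y\<close>-derivatives is
    \<open>k * e * s (x0, y0)\<close>.\<close>
  moreover have "s (x1, y0) = s (x0, y0)"
    by (rule constant_along_x[of x0 x1 s "\<lambda>x. Ds (x, y0)"]) (use s dx(3) in_U x01 y0 in auto)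
  ultimately show ?thesis
    using e dy[OF in_U[OF x01(1) y0]] dy[OF in_U[OF x01(2) y0]]
    by (simp add: x1_def field_simps)
qed

text \<open>The equations of motion of the horizontal frame \<open>(p, r)\<close> along a surface in normal
  coordinates; \<open>A = \<alpha> g\<close> and \<open>g\<close> are the coefficients of \<open>J e1\<close> and \<open>T\<close> in \<open>X\<^sub>y\<close>, and
  \<open>k\<close> is the \<open>x\<close>-derivative of \<open>A\<close>.\<close>

locale moving_frame =
  fixes U :: "(real \<times> real) set" and k :: real and A g :: "real \<times> real \<Rightarrow> real"
    and X :: "real \<times> real \<Rightarrow> heis" and u v w p r :: "real \<times> real \<Rightarrow> real"
  assumes X: "X q = (u q, v q, w q)"
    and u: "q \<in> U \<Longrightarrow> (u has_derivative (\<lambda>h. fst h * p q - snd h * (A q * r q))) (at q)"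
    and v: "q \<in> U \<Longrightarrow> (v has_derivative (\<lambda>h. fst h * r q + snd h * (A q * p q))) (at q)"
    and w: "q \<in> U \<Longrightarrow> (w has_derivative (\<lambda>h. fst h * (v q * p q - u q * r q) +
      snd h * (g q - A q * (v q * r q + u q * p q)))) (at q)"
    and unit: "q \<in> U \<Longrightarrow> (p q)\<^sup>2 + (r q)\<^sup>2 = 1"
    and p: "q \<in> U \<Longrightarrow> (p has_derivative (\<lambda>h. - (k * r q) * snd h)) (at q)"
    and r: "q \<in> U \<Longrightarrow> (r has_derivative (\<lambda>h. k * p q * snd h)) (at q)"

section \<open>Rigidity of moving frames\<close>

lemma moving_frames_congruent:
  assumes U: "open U" "connected U" "U \<noteq> {}"
    and "moving_frame U k A g X u v w p r" "moving_frame U k A g X' u' v' w' p' r'"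
  shows "rigidly_congruent U X X'"
proof -
  interpret F: moving_frame U k A g X u v w p r by fact
  interpret F': moving_frame U k A g X' u' v' w' p' r' by fact
  obtain q0 where q0: "q0 \<in> U" using U by auto
  have const: "f q = f q0" if "\<And>q. q \<in> U \<Longrightarrow> (f has_derivative (\<lambda>h. 0)) (at q)" "q \<in> U"
    for f :: "real \<times> real \<Rightarrow> real" and q
    using has_derivative_zero_unique_connected[OF U(1,2) that(1)] that(2) q0 by metis
  \<comment> \<open>Inner product and determinant of the two frames: cosine and sine of the angle
    between them. Both frames obey the same rotation equation, so these stay constant.\<close>
  define D where "D = p q0 * p' q0 + r q0 * r' q0"
  define E where "E = p q0 * r' q0 - r q0 * p' q0"
  have D: "p q * p' q + r q * r' q = D" if "q \<in> U" for q
    unfolding D_def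
    by (rule const[OF _ that], (rule derivative_eq_intros F.p F.r F'.p F'.r refl | assumption)+)
      (simp add: fun_eq_iff algebra_simps)
  have E: "p q * r' q - r q * p' q = E" if "q \<in> U" for q
    unfolding E_def
    by (rule const[OF _ that], (rule derivative_eq_intros F.p F.r F'.p F'.r refl | assumption)+)
      (simp add: fun_eq_iff algebra_simps)
  have DE: "D\<^sup>2 + E\<^sup>2 = 1"
    unfolding D_def E_def using F.unit[OF q0] F'.unit[OF q0] by algebra
  have p': "p' q = D * p q - E * r q" and r': "r' q = E * p q + D * r q" if "q \<in> U" for q
  proof -
    \<comment> \<open>Solves the relations defining \<open>D\<close> and \<open>E\<close> for the
      second frame; the determinant of this linear system is 1 by \<open>unit\<close>.\<close>
    have "D * p q - E * r q = p' q * ((p q)\<^sup>2 + (r q)\<^sup>2)"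
      "E * p q + D * r q = r' q * ((p q)\<^sup>2 + (r q)\<^sup>2)"
      unfolding D[OF that, symmetric] E[OF that, symmetric]
      by (simp_all add: power2_eq_square algebra_simps)
    then show "p' q = D * p q - E * r q" "r' q = E * p q + D * r q"
      by (simp_all add: F.unit[OF that])
  qed
  define a where "a = u' q0 - (D * u q0 - E * v q0)"
  define b where "b = v' q0 - (E * u q0 + D * v q0)"
  have a: "u' q = D * u q - E * v q + a" if "q \<in> U" for q
  proof -
    have "u' q - (D * u q - E * v q) = a"
      unfolding a_def
      by (rule const[OF _ that], (rule derivative_eq_intros F.u F.v F'.u refl | assumption)+)
        (simp add: fun_eq_iff p' r' algebra_simps)
    then show ?thesis by simp
  qed
  have b: "v' q = E * u q + D * v q + b" if "q \<in> U" for q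
  proof -
    have "v' q - (E * u q + D * v q) = b"
      unfolding b_def
      by (rule const[OF _ that], (rule derivative_eq_intros F.u F.v F'.v refl | assumption)+)
        (simp add: fun_eq_iff p' r' algebra_simps)
    then show ?thesis by simp
  qed
  \<comment> \<open>The vertical offset comes last because the group law couples it to
    \<open>a\<close> and \<open>b\<close>.\<close>
  define c where "c = w' q0 - (w q0 + b * (D * u q0 - E * v q0) - a * (E * u q0 + D * v q0))"
  have c: "w' q = w q + b * (D * u q - E * v q) - a * (E * u q + D * v q) + c" if "q \<in> U" for q
  proof -
    have "((\<lambda>q. w' q - (w q + b * (D * u q - E * v q) - a * (E * u q + D * v q)))
        has_derivative (\<lambda>h. 0)) (at q)" if q: "q \<in> U" for q
    proof -
      \<comment> \<open>The moments in the equation for \<open>w\<close> are rotation invariant up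
        to terms linear in \<open>a\<close> and \<open>b\<close>, and these match the derivatives of
        the group law correction.\<close>
      have 1: "v' q * p' q - u' q * r' q =
          v q * p q - u q * r q + b * (D * p q - E * r q) - a * (E * p q + D * r q)"
        unfolding a[OF q] b[OF q] p'[OF q] r'[OF q] using DE by algebra
      have 2: "v' q * r' q + u' q * p' q =
          v q * r q + u q * p q + b * (E * p q + D * r q) + a * (D * p q - E * r q)"
        unfolding a[OF q] b[OF q] p'[OF q] r'[OF q] using DE by algebra
      show ?thesis
        by (rule derivative_eq_intros F.u[OF q] F.v[OF q] F.w[OF q] F'.w[OF q] refl)+
          (simp add: fun_eq_iff 1 2, simp add: algebra_simps)
    qed
    from const[OF this that] show ?thesis by (simp add: c_def)
  qed
  have "X' q = rotation_translation D E a b c (X q)" if "q \<in> U" for q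
    unfolding F.X F'.X rotation_translation_def using a b c that by simp
  then show ?thesis
    unfolding rigidly_congruent_def using rigid_motion_rotation_translation[OF DE] by blast
qed

text \<open>The equations for \<open>u\<close>, \<open>v\<close>, \<open>w\<close> are the
  components of \<open>X\<^sub>x = e1\<close> and \<open>X\<^sub>y = A J e1 + g T\<close>. Those for
  \<open>p\<close>, \<open>r\<close> combine minimality in the \<open>x\<close>-direction with
  \<open>mixed_derivative\<close> in the \<open>y\<close>-direction.\<close>

lemma moving_frame_of_normal:
  assumes "open U" "embedding U X" "p_minimal_regular U X" "compatible_coordinates U X \<alpha> a b"
    and normal: "\<And>q. q \<in> U \<Longrightarrow> a q = 0 \<and> g q > 0 \<and> \<alpha> q = A q / g q \<and>
      b q = 1 / g q / sqrt (1 + (\<alpha> q)\<^sup>2)"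
    and A: "\<And>x y. (x, y) \<in> U \<Longrightarrow> A (x, y) = k * x + m y"
  shows "moving_frame U k A g X (\<lambda>q. fst (X q)) (\<lambda>q. fst (snd (X q))) (\<lambda>q. snd (snd (X q)))
    (\<lambda>q. fst (coord_dx X q)) (\<lambda>q. fst (snd (coord_dx X q)))"
proof -
  let ?u = "\<lambda>q. fst (X q)" and ?v = "\<lambda>q. fst (snd (X q))" and ?w = "\<lambda>q. snd (snd (X q))"
  let ?p = "\<lambda>q. fst (coord_dx X q)" and ?r = "\<lambda>q. fst (snd (coord_dx X q))"
  let ?D = "\<lambda>q. frechet_derivative X (at q)"
  have X: "(X has_derivative ?D q) (at q)" if "q \<in> U" for q
    using assms(2) that smooth_on_differentiable frechet_derivative_works
    by (metis embedding_def)
  have lin: "?D q h = fst h *\<^sub>R coord_dx X q + snd h *\<^sub>R coord_dy X q" if "q \<in> U" for q h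
  proof -
    have l: "linear (?D q)" using X[OF that] has_derivative_linear by blast
    have "?D q h = ?D q (fst h *\<^sub>R (1, 0) + snd h *\<^sub>R (0, 1))" by simp
    also have "\<dots> = fst h *\<^sub>R coord_dx X q + snd h *\<^sub>R coord_dy X q"
      unfolding coord_dx_def coord_dy_def by (simp only: linear_add[OF l] linear_scale[OF l])
    finally show ?thesis .
  qed
  have char: "characteristic_field U X (coord_dx X)"
    using assms(4) by (simp add: compatible_coordinates_def)
  have dx: "coord_dx X q = (?p q, ?r q, ?v q * ?p q - ?u q * ?r q)" "(?p q)\<^sup>2 + (?r q)\<^sup>2 = 1"
    if "q \<in> U" for q
  proof -
    obtain x y z p r t where [simp]: "X q = (x, y, z)" "coord_dx X q = (p, r, t)"
      by (cases "X q", cases "coord_dx X q")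
    have "contact_form (X q) (coord_dx X q) = 0" "heis_metric (X q) (coord_dx X q) (coord_dx X q) = 1"
      using char that by (auto simp: characteristic_field_def contact_plane_def)
    then show "coord_dx X q = (?p q, ?r q, ?v q * ?p q - ?u q * ?r q)" "(?p q)\<^sup>2 + (?r q)\<^sup>2 = 1"
      by (auto simp: algebra_simps power2_eq_square)
  qed
  have dy: "coord_dy X q = (- (A q * ?r q), A q * ?p q, g q - A q * (?v q * ?r q + ?u q * ?p q))"
    if q: "q \<in> U" for q
  proof -
    define c where "c = sqrt (1 + (\<alpha> q)\<^sup>2)"
    have c: "c > 0" by (simp add: c_def add_pos_nonneg)
    have g: "g q > 0" "A q = g q * \<alpha> q" using normal[OF q] by auto
    have "e2_hat X (coord_dx X) \<alpha> q = a q *\<^sub>R coord_dx X q + b q *\<^sub>R coord_dy X q"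
      using assms(4) q by (simp add: compatible_coordinates_def)
    moreover have "a q = 0" "b q = 1 / g q / c" using normal[OF q] by (auto simp: c_def)
    ultimately have "(1 / c) *\<^sub>R (\<alpha> q *\<^sub>R heis_J (X q) (coord_dx X q) + reeb (X q)) =
        (1 / g q / c) *\<^sub>R coord_dy X q"
      by (simp add: e2_hat_def c_def)
    \<comment> \<open>Clears the normalizing factors of \<open>e2_hat\<close> and of
      \<open>b\<close> at once.\<close>
    then have "(g q * c) *\<^sub>R (1 / c) *\<^sub>R (\<alpha> q *\<^sub>R heis_J (X q) (coord_dx X q) + reeb (X q)) =
        (g q * c) *\<^sub>R (1 / g q / c) *\<^sub>R coord_dy X q" by simp
    then have "coord_dy X q = g q *\<^sub>R (\<alpha> q *\<^sub>R heis_J (X q) (coord_dx X q) + reeb (X q))"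
      using c g by (simp add: field_simps)
    then show ?thesis
      unfolding g(2) by (cases "X q"; cases "coord_dx X q") (simp add: reeb_def algebra_simps)
  qed
  have D: "?D q h = (fst h * ?p q - snd h * (A q * ?r q), fst h * ?r q + snd h * (A q * ?p q),
      fst h * (?v q * ?p q - ?u q * ?r q) + snd h * (g q - A q * (?v q * ?r q + ?u q * ?p q)))"
    if "q \<in> U" for q h
    unfolding lin[OF that] dy[OF that] by (subst dx(1)[OF that]) simp
  have u: "(?u has_derivative (\<lambda>h. fst h * ?p q - snd h * (A q * ?r q))) (at q)"
    and v: "(?v has_derivative (\<lambda>h. fst h * ?r q + snd h * (A q * ?p q))) (at q)"
    and w: "(?w has_derivative (\<lambda>h. fst h * (?v q * ?p q - ?u q * ?r q) +
        snd h * (g q - A q * (?v q * ?r q + ?u q * ?p q)))) (at q)" if "q \<in> U" for q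
    using has_derivative_fst[OF X[OF that]] has_derivative_fst[OF has_derivative_snd[OF X[OF that]]]
      has_derivative_snd[OF has_derivative_snd[OF X[OF that]]]
    by (simp_all add: D[OF that])
  have "coord_dx X differentiable at q" if "q \<in> U" for q
    using char that smooth_on_differentiable by (auto simp: characteristic_field_def)
  then have "(coord_dx X has_derivative frechet_derivative (coord_dx X) (at q)) (at q)" if "q \<in> U" for q
    using that frechet_derivative_works by blast
  then have "\<exists>Dp. (?p has_derivative Dp) (at q)" "\<exists>Dr. (?r has_derivative Dr) (at q)" if "q \<in> U" for q
    using that has_derivative_fst has_derivative_snd by blast+
  then obtain Dp Dr where p: "\<And>q. q \<in> U \<Longrightarrow> (?p has_derivative Dp q) (at q)"
    and r: "\<And>q. q \<in> U \<Longrightarrow> (?r has_derivative Dr q) (at q)"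
    by metis
  have zero: "Dp q (1, 0) = 0" "Dr q (1, 0) = 0" if q: "q \<in> U" for q
  proof -
    \<comment> \<open>Minimality for the field \<open>coord_dx X\<close> on all of \<open>U\<close>;
      injectivity of the derivative then identifies the direction as \<open>(1, 0)\<close>.\<close>
    have "has_p_mean_curvature X (coord_dx X) q 0"
      using assms(1,3) char q unfolding p_minimal_regular_def p_minimal_def by blast
    then obtain h where h: "?D q h = coord_dx X q"
      "nabla X (\<lambda>s. heis_J (X s) (coord_dx X s)) q h = 0"
      by (auto simp: has_p_mean_curvature_def)
    have "inj (?D q)" using assms(2) q by (simp add: embedding_def)
    then have "h = (1, 0)" using h(1) by (auto simp: coord_dx_def dest: injD)
    moreover have "frechet_derivative ?p (at q) = Dp q"
      "frechet_derivative (\<lambda>s. - ?r s) (at q) = (\<lambda>h. - Dr q h)"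
      using frechet_derivative_at[OF p[OF q]] frechet_derivative_at[OF has_derivative_minus[OF r[OF q]]]
      by simp_all
    ultimately have "- Dr q (1, 0) *\<^sub>R frame1 (X q) + Dp q (1, 0) *\<^sub>R frame2 (X q) = 0"
      using h(2) by (simp add: nabla_def heis_J_components)
    then show "Dp q (1, 0) = 0" "Dr q (1, 0) = 0"
      by (cases "X q"; simp add: zero_prod_def)+
  qed
  have dyp: "Dp q (0, 1) = - (k * ?r q)" if "q \<in> U" for q
  proof -
    \<comment> \<open>The \<open>x\<close>-derivative of \<open>u\<close> is \<open>p\<close> and
      its \<open>y\<close>-derivative is \<open>A\<close> times \<open>- r\<close>. Below,
      \<open>v\<close> plays the same role with \<open>r\<close> and \<open>p\<close>.\<close>
    have "Dp (fst q, snd q) (0, 1) = k * (\<lambda>q. - ?r q) (fst q, snd q)"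
      by (rule mixed_derivative[OF assms(1) _ u p has_derivative_minus[OF r], where m = m])
        (use that zero A in \<open>auto simp: algebra_simps\<close>)
    then show ?thesis by simp
  qed
  have dyr: "Dr q (0, 1) = k * ?p q" if "q \<in> U" for q
  proof -
    have "Dr (fst q, snd q) (0, 1) = k * ?p (fst q, snd q)"
      by (rule mixed_derivative[OF assms(1) _ v r p, where m = m])
        (use that zero A in \<open>auto simp: algebra_simps\<close>)
    then show ?thesis by simp
  qed
  have split: "F h = snd h * F (0, 1)" if "(f has_derivative F) (at q)" "F (1, 0) = 0"
    for f :: "real \<times> real \<Rightarrow> real" and F q h
  proof -
    have l: "linear F" using that has_derivative_linear by blast
    have "F h = F (fst h *\<^sub>R (1, 0) + snd h *\<^sub>R (0, 1))" by simp
    also have "\<dots> = fst h *\<^sub>R F (1, 0) + snd h *\<^sub>R F (0, 1)"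
      by (simp only: linear_add[OF l] linear_scale[OF l])
    finally show ?thesis using that(2) by simp
  qed
  have "Dp q = (\<lambda>h. - (k * ?r q) * snd h)" "Dr q = (\<lambda>h. k * ?p q * snd h)" if "q \<in> U" for q
    using split[OF p[OF that] zero(1)[OF that]] split[OF r[OF that] zero(2)[OF that]]
      dyp[OF that] dyr[OF that] by (auto simp: fun_eq_iff)
  with p r u v w dx(2) show ?thesis
    by (unfold_locales) auto
qed

section \<open>Normal forms\<close>

text \<open>Reduces uniqueness for each type to exhibiting a positive \<open>g\<close> and an
  \<open>A\<close> affine in \<open>x\<close> with constant slope that reproduce
  \<open>\<alpha>\<close> and \<open>b\<close>.\<close>

lemma normal_coordinates_congruent:
  assumes U: "coordinate_neighborhood U"
    and "embedding U X" "p_minimal_regular U X" "compatible_coordinates U X \<alpha> a b"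
    and "embedding U X'" "p_minimal_regular U X'" "compatible_coordinates U X' \<alpha>' a' b'"
    and A: "\<And>x y. (x, y) \<in> U \<Longrightarrow> A (x, y) = k * x + m y"
    and "\<And>x y. (x, y) \<in> U \<Longrightarrow> a (x, y) = 0 \<and> g (x, y) > 0 \<and> \<alpha> (x, y) = A (x, y) / g (x, y) \<and>
      b (x, y) = 1 / g (x, y) / sqrt (1 + (\<alpha> (x, y))\<^sup>2)"
    and "\<And>x y. (x, y) \<in> U \<Longrightarrow> a' (x, y) = 0 \<and> g (x, y) > 0 \<and> \<alpha>' (x, y) = A (x, y) / g (x, y) \<and>
      b' (x, y) = 1 / g (x, y) / sqrt (1 + (\<alpha>' (x, y))\<^sup>2)"
  shows "rigidly_congruent U X X'"
proof -
  have o: "open U" "connected U" "U \<noteq> {}" using U by (auto simp: coordinate_neighborhood_def)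
  have n: "a q = 0 \<and> g q > 0 \<and> \<alpha> q = A q / g q \<and> b q = 1 / g q / sqrt (1 + (\<alpha> q)\<^sup>2)"
    "a' q = 0 \<and> g q > 0 \<and> \<alpha>' q = A q / g q \<and> b' q = 1 / g q / sqrt (1 + (\<alpha>' q)\<^sup>2)" if "q \<in> U" for q
    using that assms(9,10)[of "fst q" "snd q"] by simp_all
  show ?thesis
    by (rule moving_frames_congruent[OF o moving_frame_of_normal[OF o(1) assms(2-4) n(1) A]
          moving_frame_of_normal[OF o(1) assms(5-7) n(2) A]])
qed

text \<open>Needed to move the sign of the denominator of \<open>\<alpha>\<close> into
  \<open>A\<close> without losing a constant slope: off zero \<open>sgn\<close> is continuous, and
  its range is finite.\<close>

lemma sgn_constant_on_connected:
  fixes f :: "real \<times> real \<Rightarrow> real"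
  assumes "connected U" "continuous_on U f" "\<And>q. q \<in> U \<Longrightarrow> f q \<noteq> 0"
  obtains s where "\<And>q. q \<in> U \<Longrightarrow> sgn (f q) = s"
proof -
  have "continuous_on U (\<lambda>q. sgn (f q))" using assms by (intro continuous_intros) auto
  moreover have "finite ((\<lambda>q. sgn (f q)) ` U)"
    by (rule finite_subset[of _ "{-1, 0, 1}"]) (auto simp: sgn_real_def)
  ultimately have "(\<lambda>q. sgn (f q)) constant_on U"
    using continuous_finite_range_constant[OF assms(1)] by blast
  then show thesis using that by (auto simp: constant_on_def)
qed

lemma normal_special_I_congruent:
  assumes "coordinate_neighborhood U"
    and "embedding U X" "normal_special_I U X \<zeta>1" "embedding U X'" "normal_special_I U X' \<zeta>1"
  shows "rigidly_congruent U X X'"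
proof -
  obtain \<alpha> a b where X: "compatible_coordinates U X \<alpha> a b"
    "\<And>x y. (x, y) \<in> U \<Longrightarrow> a (x, y) = 0 \<and> x + \<zeta>1 y \<noteq> 0 \<and> \<alpha> (x, y) = 1 / (x + \<zeta>1 y) \<and>
       b (x, y) = (\<alpha> (x, y))\<^sup>2 / sqrt (1 + (\<alpha> (x, y))\<^sup>2)"
    using assms(3) unfolding normal_special_I_def by metis
  obtain \<alpha>' a' b' where X': "compatible_coordinates U X' \<alpha>' a' b'"
    "\<And>x y. (x, y) \<in> U \<Longrightarrow> a' (x, y) = 0 \<and> x + \<zeta>1 y \<noteq> 0 \<and> \<alpha>' (x, y) = 1 / (x + \<zeta>1 y) \<and>
       b' (x, y) = (\<alpha>' (x, y))\<^sup>2 / sqrt (1 + (\<alpha>' (x, y))\<^sup>2)"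
    using assms(5) unfolding normal_special_I_def by metis
  have reg: "p_minimal_regular U X" "p_minimal_regular U X'"
    using assms(3,5) by (auto simp: normal_special_I_def)
  have pos: "0 < z * z \<longleftrightarrow> z \<noteq> 0" for z :: real
    using not_real_square_gt_zero by blast
  show ?thesis
    \<comment> \<open>Here \<open>g\<close> is a square, so no sign has to be moved, and
      \<open>\<alpha>\<^sup>2 = 1 / g\<close> produces the right \<open>b\<close>.\<close>
    by (rule normal_coordinates_congruent[OF assms(1,2) reg(1) X(1) assms(4) reg(2) X'(1),
          where A = "\<lambda>(x, y). x + \<zeta>1 y" and k = 1 and m = \<zeta>1 and g = "\<lambda>(x, y). (x + \<zeta>1 y)\<^sup>2"])
      (use X(2) X'(2) in \<open>simp_all add: power2_eq_square pos\<close>)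
qed

lemma normal_special_II_congruent:
  assumes "coordinate_neighborhood U" "U \<subseteq> UNIV \<times> I" "continuous_on I \<zeta>1"
    and "embedding U X" "normal_special_II U X \<zeta>1" "embedding U X'" "normal_special_II U X' \<zeta>1"
  shows "rigidly_congruent U X X'"
proof -
  obtain \<alpha> a b where X: "compatible_coordinates U X \<alpha> a b"
    "\<And>x y. (x, y) \<in> U \<Longrightarrow> a (x, y) = 0 \<and> 2 * x + \<zeta>1 y \<noteq> 0 \<and> \<alpha> (x, y) = 1 / (2 * x + \<zeta>1 y) \<and>
       b (x, y) = \<bar>\<alpha> (x, y)\<bar> / sqrt (1 + (\<alpha> (x, y))\<^sup>2)"
    using assms(5) unfolding normal_special_II_def by metis
  obtain \<alpha>' a' b' where X': "compatible_coordinates U X' \<alpha>' a' b'"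
    "\<And>x y. (x, y) \<in> U \<Longrightarrow> a' (x, y) = 0 \<and> 2 * x + \<zeta>1 y \<noteq> 0 \<and> \<alpha>' (x, y) = 1 / (2 * x + \<zeta>1 y) \<and>
       b' (x, y) = \<bar>\<alpha>' (x, y)\<bar> / sqrt (1 + (\<alpha>' (x, y))\<^sup>2)"
    using assms(7) unfolding normal_special_II_def by metis
  have reg: "p_minimal_regular U X" "p_minimal_regular U X'"
    using assms(5,7) by (auto simp: normal_special_II_def)
  have "continuous_on U (\<lambda>q. \<zeta>1 (snd q))"
    by (rule continuous_on_compose2[OF assms(3)]) (use assms(2) in \<open>auto intro: continuous_intros\<close>)
  then have "continuous_on U (\<lambda>q. 2 * fst q + \<zeta>1 (snd q))" by (intro continuous_intros)
  moreover have "connected U" using assms(1) by (simp add: coordinate_neighborhood_def)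
  ultimately obtain s where s: "\<And>q. q \<in> U \<Longrightarrow> sgn (2 * fst q + \<zeta>1 (snd q)) = s"
    using X(2) by (rule_tac sgn_constant_on_connected[of U "\<lambda>q. 2 * fst q + \<zeta>1 (snd q)"]) auto
  have s: "sgn (2 * x + \<zeta>1 y) = s" if "(x, y) \<in> U" for x y
    using s[OF that] by simp
  have eq: "sgn z / \<bar>z\<bar> = 1 / z" for z :: real
    by (simp add: sgn_real_def)
  have "s / \<bar>2 * x + \<zeta>1 y\<bar> = 1 / (2 * x + \<zeta>1 y)" if "(x, y) \<in> U" for x y
    using eq[of "2 * x + \<zeta>1 y"] s[OF that] by simp
  then show ?thesis
    \<comment> \<open>With \<open>g\<close> the absolute value of the denominator, \<open>A\<close>
      becomes the constant \<open>s\<close>, hence slope 0.\<close>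
    by (intro normal_coordinates_congruent[OF assms(1,4) reg(1) X(1) assms(6) reg(2) X'(1),
          where A = "\<lambda>(x, y). s" and k = 0 and m = "\<lambda>y. s"
            and g = "\<lambda>(x, y). \<bar>2 * x + \<zeta>1 y\<bar>"])
      (use X(2) X'(2) in \<open>simp_all add: abs_divide\<close>)
qed

text \<open>Cancelling \<open>\<bar>x + \<zeta>1 y\<bar>\<close> merges the two cases for
  \<open>b\<close> into one formula.\<close>

lemma normal_generalE:
  assumes "normal_general U X \<zeta>1 \<zeta>2"
  obtains \<alpha> a b where "p_minimal_regular U X" "compatible_coordinates U X \<alpha> a b"
    "\<And>x y. (x, y) \<in> U \<Longrightarrow> a (x, y) = 0 \<and> (x + \<zeta>1 y)\<^sup>2 + \<zeta>2 y \<noteq> 0 \<and>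
       \<alpha> (x, y) = (x + \<zeta>1 y) / ((x + \<zeta>1 y)\<^sup>2 + \<zeta>2 y) \<and>
       b (x, y) = 1 / \<bar>(x + \<zeta>1 y)\<^sup>2 + \<zeta>2 y\<bar> / sqrt (1 + (\<alpha> (x, y))\<^sup>2)"
proof -
  have quot: "(if z = 0 then 1 / \<bar>z\<^sup>2 + t\<bar> else \<bar>z / (z\<^sup>2 + t)\<bar> / \<bar>z\<bar>) = 1 / \<bar>z\<^sup>2 + t\<bar>" for z t :: real
    by simp
  show thesis
    using assms unfolding normal_general_def
    by (elim conjE exE, rule_tac that) (assumption, assumption, use quot in fastforce)
qed

lemma normal_general_congruent:
  assumes "coordinate_neighborhood U" "U \<subseteq> UNIV \<times> I" "continuous_on I \<zeta>1" "continuous_on I \<zeta>2"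
    and "embedding U X" "normal_general U X \<zeta>1 \<zeta>2" "embedding U X'" "normal_general U X' \<zeta>1 \<zeta>2"
  shows "rigidly_congruent U X X'"
proof -
  obtain \<alpha> a b where reg: "p_minimal_regular U X" and X: "compatible_coordinates U X \<alpha> a b"
    "\<And>x y. (x, y) \<in> U \<Longrightarrow> a (x, y) = 0 \<and> (x + \<zeta>1 y)\<^sup>2 + \<zeta>2 y \<noteq> 0 \<and>
       \<alpha> (x, y) = (x + \<zeta>1 y) / ((x + \<zeta>1 y)\<^sup>2 + \<zeta>2 y) \<and>
       b (x, y) = 1 / \<bar>(x + \<zeta>1 y)\<^sup>2 + \<zeta>2 y\<bar> / sqrt (1 + (\<alpha> (x, y))\<^sup>2)"
    by (rule normal_generalE[OF assms(6)]) (rule that, assumption, assumption, blast)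
  obtain \<alpha>' a' b' where reg': "p_minimal_regular U X'" and X': "compatible_coordinates U X' \<alpha>' a' b'"
    "\<And>x y. (x, y) \<in> U \<Longrightarrow> a' (x, y) = 0 \<and> (x + \<zeta>1 y)\<^sup>2 + \<zeta>2 y \<noteq> 0 \<and>
       \<alpha>' (x, y) = (x + \<zeta>1 y) / ((x + \<zeta>1 y)\<^sup>2 + \<zeta>2 y) \<and>
       b' (x, y) = 1 / \<bar>(x + \<zeta>1 y)\<^sup>2 + \<zeta>2 y\<bar> / sqrt (1 + (\<alpha>' (x, y))\<^sup>2)"
    by (rule normal_generalE[OF assms(8)]) (rule that, assumption, assumption, blast)
  have "continuous_on U (\<lambda>q. \<zeta>1 (snd q))" "continuous_on U (\<lambda>q. \<zeta>2 (snd q))"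
    by (rule continuous_on_compose2[OF assms(3)] continuous_on_compose2[OF assms(4)];
        use assms(2) in \<open>auto intro: continuous_intros\<close>)+
  then have "continuous_on U (\<lambda>q. (fst q + \<zeta>1 (snd q))\<^sup>2 + \<zeta>2 (snd q))" by (intro continuous_intros)
  moreover have "connected U" using assms(1) by (simp add: coordinate_neighborhood_def)
  ultimately obtain s where s: "\<And>q. q \<in> U \<Longrightarrow> sgn ((fst q + \<zeta>1 (snd q))\<^sup>2 + \<zeta>2 (snd q)) = s"
    using X(2) by (rule_tac sgn_constant_on_connected[of U "\<lambda>q. (fst q + \<zeta>1 (snd q))\<^sup>2 + \<zeta>2 (snd q)"]) auto
  have s: "sgn ((x + \<zeta>1 y)\<^sup>2 + \<zeta>2 y) = s" if "(x, y) \<in> U" for x y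
    using s[OF that] by simp
  have eq: "t / z = sgn z * t / \<bar>z\<bar>" for z t :: real
    by (simp add: sgn_real_def)
  have "s * (x + \<zeta>1 y) / \<bar>(x + \<zeta>1 y)\<^sup>2 + \<zeta>2 y\<bar> = (x + \<zeta>1 y) / ((x + \<zeta>1 y)\<^sup>2 + \<zeta>2 y)"
    if "(x, y) \<in> U" for x y
    using eq[of "x + \<zeta>1 y" "(x + \<zeta>1 y)\<^sup>2 + \<zeta>2 y"] s[OF that] by simp
  then show ?thesis
    \<comment> \<open>The slope of \<open>A\<close> is the sign \<open>s\<close> of the denominator,
      constant because \<open>U\<close> is connected.\<close>
    by (intro normal_coordinates_congruent[OF assms(1,5) reg X(1) assms(7) reg' X'(1),
          where A = "\<lambda>(x, y). s * (x + \<zeta>1 y)" and k = s and m = "\<lambda>y. s * \<zeta>1 y"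
            and g = "\<lambda>(x, y). \<bar>(x + \<zeta>1 y)\<^sup>2 + \<zeta>2 y\<bar>"])
      (use X(2) X'(2) in \<open>simp_all add: distrib_left\<close>)
qed

section \<open>Existence for each type\<close>

lemma exists_special_I:
  fixes c d :: ereal
  assumes "c < d" "smooth_on \<zeta>1 (einterval c d)"
  shows "\<exists>U X. coordinate_neighborhood U \<and> U \<subseteq> UNIV \<times> einterval c d \<and>
    embedding U X \<and> normal_special_I U X \<zeta>1"
proof -
  obtain y0 where y0: "y0 \<in> einterval c d" using ereal_dense2[OF assms(1)] by (auto simp: einterval_iff)
  have sq: "x\<^sup>2 + 2 * z * x + z\<^sup>2 = (x + z)\<^sup>2" for x z :: real
    by (simp add: power2_eq_square algebra_simps)
  have o: "open (einterval c d)" by simp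
  obtain U X where UX: "coordinate_neighborhood U" "U \<subseteq> UNIV \<times> einterval c d" "embedding U X"
    "p_minimal_regular U X"
    "\<And>x y. (x, y) \<in> U \<Longrightarrow> 1 * x + \<zeta>1 y > 0 \<and> 1 * x\<^sup>2 + 2 * \<zeta>1 y * x + \<zeta>1 y * \<zeta>1 y > 0"
    "compatible_coordinates U X
       (\<lambda>(x, y). (1 * x + \<zeta>1 y) / (1 * x\<^sup>2 + 2 * \<zeta>1 y * x + \<zeta>1 y * \<zeta>1 y)) (\<lambda>q. 0)
       (\<lambda>(x, y). 1 / (1 * x\<^sup>2 + 2 * \<zeta>1 y * x + \<zeta>1 y * \<zeta>1 y) /
          sqrt (1 + ((1 * x + \<zeta>1 y) / (1 * x\<^sup>2 + 2 * \<zeta>1 y * x + \<zeta>1 y * \<zeta>1 y))\<^sup>2))"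
    \<comment> \<open>The base point is chosen so that \<open>x + \<zeta>1 y = 1\<close>, which
      gives \<open>A = G = 1\<close> there.\<close>
    by (rule exists_normal_surface[OF assms smooth_on_mult[OF o assms(2) assms(2)] y0,
          of 1 "1 - \<zeta>1 y0"]) (simp_all add: power2_eq_square algebra_simps)
  \<comment> \<open>The factors \<open>1\<close> matched the case \<open>k = 1\<close> of the
    general formula; now they are removed and the square is completed.\<close>
  note UX = UX[unfolded power2_eq_square[of "\<zeta>1 _", symmetric] mult_1 sq]
  have eq: "z / z\<^sup>2 = 1 / z \<and> 1 / z\<^sup>2 = (1 / z)\<^sup>2" for z :: real
    by (simp add: power2_eq_square)
  have "normal_special_I U X \<zeta>1"
    unfolding normal_special_I_def
    by (intro conjI exI, rule UX(4), rule UX(6)) (use UX(5) eq in force)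
  with UX show ?thesis by blast
qed

lemma exists_special_II:
  fixes c d :: ereal
  assumes "c < d" "smooth_on \<zeta>1 (einterval c d)"
  shows "\<exists>U X. coordinate_neighborhood U \<and> U \<subseteq> UNIV \<times> einterval c d \<and>
    embedding U X \<and> normal_special_II U X \<zeta>1"
proof -
  obtain y0 where y0: "y0 \<in> einterval c d" using ereal_dense2[OF assms(1)] by (auto simp: einterval_iff)
  have o: "open (einterval c d)" by simp
  obtain U X where UX: "coordinate_neighborhood U" "U \<subseteq> UNIV \<times> einterval c d" "embedding U X"
    "p_minimal_regular U X"
    "\<And>x y. (x, y) \<in> U \<Longrightarrow> 0 * x + 1 > 0 \<and> 0 * x\<^sup>2 + 2 * 1 * x + \<zeta>1 y > 0"
    "compatible_coordinates U X
       (\<lambda>(x, y). (0 * x + 1) / (0 * x\<^sup>2 + 2 * 1 * x + \<zeta>1 y)) (\<lambda>q. 0)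
       (\<lambda>(x, y). 1 / (0 * x\<^sup>2 + 2 * 1 * x + \<zeta>1 y) /
          sqrt (1 + ((0 * x + 1) / (0 * x\<^sup>2 + 2 * 1 * x + \<zeta>1 y))\<^sup>2))"
    \<comment> \<open>At this base point the denominator \<open>2 * x + \<zeta>1 y\<close> equals
      1.\<close>
    by (rule exists_normal_surface[OF assms(1) smooth_on_const[OF o, of 1] assms(2) y0,
          of 0 "(1 - \<zeta>1 y0) / 2"]) (simp_all add: field_simps)
  have "normal_special_II U X \<zeta>1"
    unfolding normal_special_II_def
    by (intro conjI exI, rule UX(4), rule UX(6)) (use UX(5) in force)
  with UX show ?thesis by blast
qed

lemma exists_general:
  fixes c d :: ereal
  assumes "c < d" "smooth_on \<zeta>1 (einterval c d)" "smooth_on \<zeta>2 (einterval c d)"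
    and nz: "\<forall>y\<in>einterval c d. \<zeta>2 y \<noteq> 0"
  shows "\<exists>U X. coordinate_neighborhood U \<and> U \<subseteq> UNIV \<times> einterval c d \<and>
    embedding U X \<and> normal_general U X \<zeta>1 \<zeta>2"
proof -
  obtain y0 where y0: "y0 \<in> einterval c d" using ereal_dense2[OF assms(1)] by (auto simp: einterval_iff)
  have o: "open (einterval c d)" by simp
  have sq: "x\<^sup>2 + 2 * z * x + (z * z + t) = (x + z)\<^sup>2 + t" for x z t :: real
    by (simp add: power2_eq_square algebra_simps)
  have pos: "(1 + \<bar>t\<bar>)\<^sup>2 + t > 0" for t :: real
  proof -
    have "(1 + \<bar>t\<bar>)\<^sup>2 + t = 1 + t\<^sup>2 + \<bar>t\<bar> + (\<bar>t\<bar> + t)"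
      by (simp add: power2_eq_square algebra_simps)
    then show ?thesis using zero_le_power2[of t] abs_ge_minus_self[of t] by linarith
  qed
  obtain U X where UX: "coordinate_neighborhood U" "U \<subseteq> UNIV \<times> einterval c d" "embedding U X"
    "p_minimal_regular U X"
    "\<And>x y. (x, y) \<in> U \<Longrightarrow> 1 * x + \<zeta>1 y > 0 \<and> 1 * x\<^sup>2 + 2 * \<zeta>1 y * x + (\<zeta>1 y * \<zeta>1 y + \<zeta>2 y) > 0"
    "compatible_coordinates U X
       (\<lambda>(x, y). (1 * x + \<zeta>1 y) / (1 * x\<^sup>2 + 2 * \<zeta>1 y * x + (\<zeta>1 y * \<zeta>1 y + \<zeta>2 y))) (\<lambda>q. 0)
       (\<lambda>(x, y). 1 / (1 * x\<^sup>2 + 2 * \<zeta>1 y * x + (\<zeta>1 y * \<zeta>1 y + \<zeta>2 y)) /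
          sqrt (1 + ((1 * x + \<zeta>1 y) / (1 * x\<^sup>2 + 2 * \<zeta>1 y * x + (\<zeta>1 y * \<zeta>1 y + \<zeta>2 y)))\<^sup>2))"
    \<comment> \<open>The base point has \<open>x + \<zeta>1 y = 1 + \<bar>\<zeta>2 y\<bar>\<close>,
      large enough by \<open>pos\<close> to outweigh a negative \<open>\<zeta>2\<close>.\<close>
    by (rule exists_normal_surface[OF assms(1,2)
          smooth_on_add[OF o smooth_on_mult[OF o assms(2) assms(2)] assms(3)] y0,
          of 1 "1 + \<bar>\<zeta>2 y0\<bar> - \<zeta>1 y0"]) (simp_all add: sq pos)
  note UX = UX[unfolded mult_1 sq]
  have "normal_general U X \<zeta>1 \<zeta>2"
    unfolding normal_general_def
  proof (intro conjI exI, rule UX(4), rule UX(6), intro allI impI)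
    fix x y assume q: "(x, y) \<in> U"
    then have "x + \<zeta>1 y > 0" "(x + \<zeta>1 y)\<^sup>2 + \<zeta>2 y > 0" "\<zeta>2 y \<noteq> 0"
      using UX(2,5) nz by auto
    then show "(0::real) = 0 \<and> \<zeta>2 y \<noteq> 0 \<and> (x + \<zeta>1 y)\<^sup>2 + \<zeta>2 y \<noteq> 0 \<and>
      (case (x, y) of (x, y) \<Rightarrow> (x + \<zeta>1 y) / ((x + \<zeta>1 y)\<^sup>2 + \<zeta>2 y)) =
        (x + \<zeta>1 y) / ((x + \<zeta>1 y)\<^sup>2 + \<zeta>2 y) \<and>
      (case (x, y) of (x, y) \<Rightarrow> 1 / ((x + \<zeta>1 y)\<^sup>2 + \<zeta>2 y) /
          sqrt (1 + ((x + \<zeta>1 y) / ((x + \<zeta>1 y)\<^sup>2 + \<zeta>2 y))\<^sup>2)) =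
        (if x + \<zeta>1 y = 0 then 1 / \<bar>(x + \<zeta>1 y)\<^sup>2 + \<zeta>2 y\<bar>
         else \<bar>case (x, y) of (x, y) \<Rightarrow> (x + \<zeta>1 y) / ((x + \<zeta>1 y)\<^sup>2 + \<zeta>2 y)\<bar> / \<bar>x + \<zeta>1 y\<bar>) /
        sqrt (1 + (case (x, y) of (x, y) \<Rightarrow> (x + \<zeta>1 y) / ((x + \<zeta>1 y)\<^sup>2 + \<zeta>2 y))\<^sup>2)"
      by (simp add: abs_divide)
  qed
  with UX show ?thesis by blast
qed

theorem theorem1p5:
  fixes c d :: ereal and \<zeta>1 \<zeta>2 :: "real \<Rightarrow> real"
  assumes "c < d"
    and "smooth_on \<zeta>1 (einterval c d)"
    and "smooth_on \<zeta>2 (einterval c d)"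
    and "\<forall>y\<in>einterval c d. \<zeta>2 y \<noteq> 0"
  shows
    "(\<exists>(e::ereal) f U X. coordinate_neighborhood U \<and> U \<subseteq> einterval e f \<times> einterval c d \<and>
        embedding U X \<and> normal_special_I U X \<zeta>1) \<and>
     (\<exists>(e::ereal) f U X. coordinate_neighborhood U \<and> U \<subseteq> einterval e f \<times> einterval c d \<and>
        embedding U X \<and> normal_special_II U X \<zeta>1) \<and>
     (\<exists>(e::ereal) f U X. coordinate_neighborhood U \<and> U \<subseteq> einterval e f \<times> einterval c d \<and>
        embedding U X \<and> normal_general U X \<zeta>1 \<zeta>2) \<and>
     (\<forall>(e::ereal) f U. coordinate_neighborhood U \<and> U \<subseteq> einterval e f \<times> einterval c d \<longrightarrow>
        (\<forall>X X'. embedding U X \<and> normal_special_I U X \<zeta>1 \<and>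
                embedding U X' \<and> normal_special_I U X' \<zeta>1 \<longrightarrow> rigidly_congruent U X X') \<and>
        (\<forall>X X'. embedding U X \<and> normal_special_II U X \<zeta>1 \<and>
                embedding U X' \<and> normal_special_II U X' \<zeta>1 \<longrightarrow> rigidly_congruent U X X') \<and>
        (\<forall>X X'. embedding U X \<and> normal_general U X \<zeta>1 \<zeta>2 \<and>
                embedding U X' \<and> normal_general U X' \<zeta>1 \<zeta>2 \<longrightarrow> rigidly_congruent U X X'))"
proof -
  have smooth: "smooth_on \<zeta>1 (einterval c d)" "smooth_on \<zeta>2 (einterval c d)"
    using assms by auto
  note cont = smooth[THEN smooth_on_imp_continuous_on]
  \<comment> \<open>Infinite endpoints serve as \<open>e\<close> and \<open>f\<close>, so
    \<open>einterval e f\<close> is the whole line.\<close>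
  have UNIV: "\<exists>(e::ereal) f. U \<subseteq> einterval e f \<times> einterval c d"
    if "U \<subseteq> UNIV \<times> einterval c d" for U
    using that by (metis einterval_eq_UNIV)
  have sub: "U \<subseteq> UNIV \<times> einterval c d" if "U \<subseteq> einterval e f \<times> einterval c d"
    for U and e f :: ereal
    using that by blast
  show ?thesis
    apply (intro conjI allI impI; (elim conjE)?)
    subgoal using exists_special_I[OF assms(1) smooth(1)] UNIV by metis
    subgoal using exists_special_II[OF assms(1) smooth(1)] UNIV by metis
    subgoal using exists_general[OF assms(1) smooth assms(4)] UNIV by metis
    subgoal by (rule normal_special_I_congruent)
    subgoal by (rule normal_special_II_congruent[OF _ sub cont(1)])
    subgoal by (rule normal_general_congruent[OF _ sub cont])
    done
qed

end
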